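(* The set $GL_n(\mathbb{R}[t,t^{-1}])_{\geq 0}$ of totally nonnegative elements of $GL_n(\mathbb{R}[t,t^{-1}])$ is, as a multiplicative semigroup, generated by the shift matrices $S, S^{-1}$, the positive torus $T_{>0}$, and the Chevalley generators with positive parameters $$\{e_1(a), e_2(a),\ldots,e_n(a) \mid a>0\}\ \cup\ \{f_1(a),f_2(a),\ldots,f_n(a)\mid a>0\}.$$
   Context: Fix an integer $n\ge 1$. $GL_n(\mathbb{R}[t,t^{-1}])$ is the group of $n\times n$ matrices with real Laurent polynomial entries whose determinant is a non-zero monomial. To $A(t)=(a_{ij}(t))_{i,j=1}^n$ one associates its unfolding: the doubly infinite real matrix $X=(x_{i,j})_{i,j\in\mathbb{Z}}$ with $x_{i+n,j+n}=x_{i,j}$ for all $i,j$ and $a_{ij}(t)=\sum_{k\in\mathbb{Z}}x_{i,j+kn}t^k$ for $1\le i,j\le n$. This correspondence is bijective and compatible with multiplication, and $A(t)$ is identified with $X$. $X$ is totally nonnegative if every finite minor of the infinite matrix $X$ is nonnegative. $T_{>0}$ is the set of $n\times n$ diagonal matrices with positive real (constant) entries, viewed in $GL_n(\mathbb{R}[t,t^{-1}])$. $S=(s_{ij})_{i,j\in\mathbb{Z}}$ is given by $s_{ij}=1$ if $j=i+1$ and $s_{ij}=0$ otherwise. For $a\in\mathbb{R}$ and $k\in\mathbb{Z}$, $e_k(a)=(x_{i,j})$ has $x_{i,i}=1$, $x_{i,i+1}=a$ if $i\equiv k \pmod n$, and all other entries $0$; $f_k(a)$ is the transpose of $e_k(a)$.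 When $n=1$ there are, by convention, no Chevalley generators. *)

theory Defs
  imports
    "HOL-Library.Poly_Mapping"
    "HOL-Number_Theory.Cong"
    "Jordan_Normal_Form.Determinant"
begin

text \<open>
  Finitely supported functions \<open>int \<Rightarrow>\<^sub>0 real\<close> with convolution as multiplication are the ring of
  real Laurent polynomials; \<open>lookup p k\<close> is the coefficient of $t^k$ and \<open>single k c\<close> is $c t^k$.
\<close>

type_synonym laurent = "int \<Rightarrow>\<^sub>0 real"

type_synonym bimatrix = "int \<Rightarrow> int \<Rightarrow> real"

definition GL_laurent :: "nat \<Rightarrow> laurent mat set" where
  "GL_laurent n = {A \<in> carrier_mat n n. \<exists>k c. c \<noteq> 0 \<and> det A = Poly_Mapping.single k c}"

text \<open>
  Rows and columns of \<open>laurent mat\<close> are numbered from 0, whereas the block $1,\dots,n$ of the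
  doubly infinite matrix corresponds to $A(t)$; hence the index shifts by one.
  Writing $i = i_0 + pn$ and $j = j_0 + qn$ with $1 \le i_0, j_0 \le n$, the entry $x_{i,j}$ is the
  coefficient of $t^{q-p}$ in $a_{i_0 j_0}$.
\<close>

definition unfolding_mat :: "nat \<Rightarrow> laurent mat \<Rightarrow> bimatrix" where
  "unfolding_mat n A = (\<lambda>i j.
     Poly_Mapping.lookup (A $$ (nat ((i - 1) mod int n), nat ((j - 1) mod int n)))
       ((j - 1) div int n - (i - 1) div int n))"

text \<open>
  The inverse correspondence. It is meaningful only if the rows of \<open>X\<close> have finite support, as
  otherwise \<open>Abs_poly_mapping\<close> is unspecified.
\<close>

definition folding_mat :: "nat \<Rightarrow> bimatrix \<Rightarrow> laurent mat" where
  "folding_mat n X = mat n n (\<lambda>(i, j).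
     Abs_poly_mapping (\<lambda>k. X (int i + 1) (int j + 1 + k * int n)))"

lemma unfolding_mat_periodic:
  assumes "n \<ge> 1"
  shows "unfolding_mat n A (i + int n) (j + int n) = unfolding_mat n A i j"
proof -
  have "(m + int n - 1) mod int n = (m - 1) mod int n"
    and "(m + int n - 1) div int n = (m - 1) div int n + 1" for m
    using assms mod_add_self2[of "m - 1" "int n"] div_add_self2[of "int n" "m - 1"]
    by (simp_all add: algebra_simps)
  then show ?thesis
    by (simp add: unfolding_mat_def)
qed

lemma lookup_eq_unfolding_mat:
  assumes "i < n" "j < n"
  shows "Poly_Mapping.lookup (A $$ (i, j)) k =
    unfolding_mat n A (int i + 1) (int j + 1 + k * int n)"
  using assms by (simp add: unfolding_mat_def)

lemma folding_unfolding:
  assumes "A \<in> carrier_mat n n"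
  shows "folding_mat n (unfolding_mat n A) = A"
  using assms
  by (intro eq_matI) (simp_all add: folding_mat_def flip: lookup_eq_unfolding_mat)

lemma unfolding_folding:
  assumes "n \<ge> 1"
    and per: "\<And>i j. X (i + int n) (j + int n) = X i j"
    and fin: "\<And>i. finite {j. X i j \<noteq> 0}"
  shows "unfolding_mat n (folding_mat n X) = X"
proof (intro ext)
  fix i j :: int
  define p q where "p = (i - 1) div int n" and "q = (j - 1) div int n"
  define i0 j0 where "i0 = (i - 1) mod int n" and "j0 = (j - 1) mod int n"
  have ij: "i = i0 + 1 + p * int n" "j = j0 + 1 + q * int n"
    by (simp_all add: p_def q_def i0_def j0_def)
  have bounds: "0 \<le> i0" "i0 < int n" "0 \<le> j0" "j0 < int n"
    using assms(1) by (simp_all add: i0_def j0_def)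
  have pern: "X (a + int m * int n) (b + int m * int n) = X a b" for a b m
  proof (induction m)
    case (Suc m)
    then show ?case
      using per[of "a + int m * int n" "b + int m * int n"] by (simp add: algebra_simps)
  qed simp
  have perz: "X (a + m * int n) (b + m * int n) = X a b" for a b m
  proof (cases "m \<ge> 0")
    case True
    then show ?thesis using pern[of a "nat m" b] by simp
  next
    case False
    then show ?thesis
      using pern[of "a + m * int n" "nat (- m)" "b + m * int n"] by (simp add: algebra_simps)
  qed
  have "finite ((\<lambda>k. j0 + 1 + k * int n) -` {j. X (i0 + 1) j \<noteq> 0})"
    by (rule finite_vimageI[OF fin]) (use assms(1) in \<open>auto simp: inj_on_def\<close>)
  then have "finite {k. X (i0 + 1) (j0 + 1 + k * int n) \<noteq> 0}"
    by (simp add: vimage_def)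
  then have "unfolding_mat n (folding_mat n X) i j = X (i0 + 1) (j0 + 1 + (q - p) * int n)"
    using bounds
    by (simp add: unfolding_mat_def folding_mat_def nat_less_iff Abs_poly_mapping_inverse
        flip: i0_def j0_def p_def q_def)
  also have "\<dots> = X (i0 + 1 + p * int n) (j0 + 1 + (q - p) * int n + p * int n)"
    by (rule perz[symmetric])
  also have "\<dots> = X i j"
    by (simp add: ij algebra_simps)
  finally show "unfolding_mat n (folding_mat n X) i j = X i j" .
qed

definition minor :: "bimatrix \<Rightarrow> nat \<Rightarrow> (nat \<Rightarrow> int) \<Rightarrow> (nat \<Rightarrow> int) \<Rightarrow> real" where
  "minor X m r c = det (mat m m (\<lambda>(a, b). X (r a) (c b)))"

definition totally_nonnegative :: "bimatrix \<Rightarrow> bool" where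
  "totally_nonnegative X \<longleftrightarrow>
     (\<forall>m r c. strict_mono_on {..<m} r \<longrightarrow> strict_mono_on {..<m} c \<longrightarrow> minor X m r c \<ge> 0)"

definition GL_laurent_nonneg :: "nat \<Rightarrow> laurent mat set" where
  "GL_laurent_nonneg n = {A \<in> GL_laurent n. totally_nonnegative (unfolding_mat n A)}"

definition positive_torus :: "nat \<Rightarrow> laurent mat set" where
  "positive_torus n = {mat_diag n (\<lambda>i. Poly_Mapping.single 0 (d i)) | d. \<forall>i<n. d i > 0}"

definition shift_bimatrix :: bimatrix where
  "shift_bimatrix = (\<lambda>i j. if j = i + 1 then 1 else 0)"

definition shift_mat :: "nat \<Rightarrow> laurent mat" where
  "shift_mat n = folding_mat n shift_bimatrix"

lemma unfolding_shift_mat: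
  "n \<ge> 1 \<Longrightarrow> unfolding_mat n (shift_mat n) = shift_bimatrix"
  unfolding shift_mat_def
  by (rule unfolding_folding) (auto simp: shift_bimatrix_def)

definition shift_inverses :: "nat \<Rightarrow> laurent mat set" where
  "shift_inverses n =
     {B \<in> carrier_mat n n. inverts_mat (shift_mat n) B \<and> inverts_mat B (shift_mat n)}"

definition chevalley_e_bimatrix :: "nat \<Rightarrow> int \<Rightarrow> real \<Rightarrow> bimatrix" where
  "chevalley_e_bimatrix n k a = (\<lambda>i j.
     if j = i then 1 else if j = i + 1 \<and> [i = k] (mod int n) then a else 0)"

definition chevalley_e :: "nat \<Rightarrow> int \<Rightarrow> real \<Rightarrow> laurent mat" where
  "chevalley_e n k a = folding_mat n (chevalley_e_bimatrix n k a)"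

definition chevalley_f :: "nat \<Rightarrow> int \<Rightarrow> real \<Rightarrow> laurent mat" where
  "chevalley_f n k a = folding_mat n (\<lambda>i j. chevalley_e_bimatrix n k a j i)"

lemma chevalley_e_bimatrix_periodic:
  "chevalley_e_bimatrix n k a (i + int n) (j + int n) = chevalley_e_bimatrix n k a i j"
  by (auto simp: chevalley_e_bimatrix_def cong_def)

lemma unfolding_chevalley_e:
  assumes "n \<ge> 1"
  shows "unfolding_mat n (chevalley_e n k a) = chevalley_e_bimatrix n k a"
proof -
  have "finite {j. chevalley_e_bimatrix n k a i j \<noteq> 0}" for i
    by (rule finite_subset[of _ "{i, i + 1}"]) (auto simp: chevalley_e_bimatrix_def)
  then show ?thesis
    unfolding chevalley_e_def
    using assms chevalley_e_bimatrix_periodic by (intro unfolding_folding) auto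
qed

lemma unfolding_chevalley_f:
  assumes "n \<ge> 1"
  shows "unfolding_mat n (chevalley_f n k a) = (\<lambda>i j. chevalley_e_bimatrix n k a j i)"
proof -
  have "finite {j. chevalley_e_bimatrix n k a j i \<noteq> 0}" for i
    by (rule finite_subset[of _ "{i, i - 1}"]) (auto simp: chevalley_e_bimatrix_def)
  then show ?thesis
    unfolding chevalley_f_def
    using assms chevalley_e_bimatrix_periodic by (intro unfolding_folding) auto
qed

text \<open>By convention there are no Chevalley generators when $n = 1$.\<close>

definition positive_chevalley_generators :: "nat \<Rightarrow> laurent mat set" where
  "positive_chevalley_generators n =
     (if n = 1 then {}
      else {chevalley_e n k a | k a. 1 \<le> k \<and> k \<le> int n \<and> a > 0} \<union>
           {chevalley_f n k a | k a. 1 \<le> k \<and> k \<le> int n \<and> a > 0})"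

inductive_set generated_semigroup :: "'a::semiring_0 mat set \<Rightarrow> 'a mat set" for G where
  generator: "A \<in> G \<Longrightarrow> A \<in> generated_semigroup G"
| mult: "A \<in> generated_semigroup G \<Longrightarrow> B \<in> generated_semigroup G \<Longrightarrow>
    A * B \<in> generated_semigroup G"

end

theory Submission
  imports Defs
begin

text \<open>
  All arguments take place among the unfolded matrices, that is, the doubly infinite matrices that are periodic,
  banded, and have an inverse of the same kind (\<open>loop_group\<close>).

  Products of generators are totally nonnegative because the identity is, and left multiplication by each
  generator preserves total nonnegativity. This is clear for shifts and for the torus. A Chevalley generator is bidiagonal with
  nonnegative entries, and expanding a minor of the product row by row expresses it
  as a nonnegative combination of minors of the other factor (\<open>totally_nonnegative_bidiagonal\<close>).

  Conversely, a totally nonnegative matrix \<open>X\<close> is factored by Whitney's elimination. By the \<open>2 \<times> 2\<close> minors, the column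
  of the first nonzero entry of row \<open>i\<close> is weakly increasing in \<open>i\<close>. If it is the same for the rows \<open>i\<close> and
  \<open>i + 1\<close>, and row \<open>i + 1\<close> is the last such row, subtract from row \<open>i + 1\<close> the multiple of row \<open>i\<close> that
  clears the entry in this column, and do the same at all translates by multiples of \<open>n\<close>. This strips off a factor
  \<open>f_i(a)\<close> with \<open>a > 0\<close>. The heart of the proof is that the result is still totally nonnegative
  (\<open>totally_nonnegative_whitney\<close>). This follows from an inequality between minors
  (\<open>whitney_minor_inequality\<close>), which in turn comes from the three-term Pluecker relation.

  As \<open>X\<close> is banded, the elimination stops. The first nonzero entries then lie in strictly increasing columns,
  and periodicity forces them onto one diagonal \<open>j = i + s\<close>. After removing the factor \<open>S^s\<close>, the
  matrix is upper triangular with positive diagonal. Reversing the order of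
  rows and columns makes it lower triangular and exchanges the roles of the \<open>e\<close> and \<open>f\<close>
  generators, so the same elimination applies once more. It ends with a lower triangular matrix whose rows
  are nonzero on the diagonals \<open>j = i\<close> and \<open>j = i + s'\<close> and supported between them. Such a matrix has a banded inverse
  only if \<open>s' = 0\<close> (\<open>triangular_extreme_diagonals\<close>), and then it belongs to the torus. The
  hypothesis on the determinant enters through this banded inverse, which also keeps all rows nonzero
  during the elimination.
\<close>

section \<open>The three-term Pluecker relation\<close>

text \<open>
  The determinant as a bilinear alternating form in the rows number \<open>s\<close> and \<open>t\<close>, the other rows
  being taken from \<open>R\<close>.
\<close>

definition det_with_rows :: "(nat \<Rightarrow> nat \<Rightarrow> real) \<Rightarrow> nat \<Rightarrow> nat \<Rightarrow> nat \<Rightarrow> (nat \<Rightarrow> real) \<Rightarrow> (nat \<Rightarrow> real) \<Rightarrow> real" where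
  "det_with_rows R m s t x y = det (mat m m (\<lambda>(a, b). if a = s then x b else if a = t then y b else R a b))"

lemma det_with_rows_swap:
  assumes "s < m" "t < m" "s \<noteq> t"
  shows "det_with_rows R m s t y x = - det_with_rows R m s t x y"
proof -
  let ?A = "mat m m (\<lambda>(a, b). if a = s then x b else if a = t then y b else R a b)"
  have "det_with_rows R m s t y x = det (swaprows s t ?A)"
    unfolding det_with_rows_def
    by (intro arg_cong[where f = det] eq_matI) (use assms in \<open>auto simp: mat_swaprows_def\<close>)
  also have "\<dots> = - det ?A"
    by (rule det_swaprows) (use assms in auto)
  finally show ?thesis by (simp add: det_with_rows_def)
qed

lemma det_with_rows_expand:
  assumes "s < m"
  shows "det_with_rows R m s t x y = (\<Sum>b<m. x b * det_with_rows R m s t (\<lambda>b'. if b' = b then 1 else 0) y)"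
proof -
  let ?A = "\<lambda>x. mat m m (\<lambda>(a, b). if a = s then x b else if a = t then y b else R a b)"
  have del: "mat_delete (?A x) s b = mat_delete (?A x') s b" for x x' b
    by (auto simp: mat_delete_def)
  have ex: "det_with_rows R m s t x y = (\<Sum>b<m. x b * cofactor (?A x) s b)" for x
    unfolding det_with_rows_def
    by (subst laplace_expansion_row[where i = s]) (use assms in auto)
  have unit: "det_with_rows R m s t (\<lambda>b'. if b' = b then 1 else 0) y = cofactor (?A x) s b" if "b < m" for b
  proof -
    have "det_with_rows R m s t (\<lambda>b'. if b' = b then 1 else 0) y =
      (\<Sum>b'<m. if b' = b then cofactor (?A (\<lambda>b'. if b' = b then 1 else 0)) s b else 0)"
      unfolding ex by (intro sum.cong) auto
    also have "\<dots> = cofactor (?A (\<lambda>b'. if b' = b then 1 else 0)) s b"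
      using that by simp
    also have "\<dots> = cofactor (?A x) s b"
      unfolding cofactor_def by (subst del[where x' = x]) (rule refl)
    finally show ?thesis .
  qed
  show ?thesis
    by (subst ex) (simp add: unit)
qed

lemma det_with_rows_sum:
  assumes "s < m"
  shows "det_with_rows R m s t (\<lambda>b. \<Sum>i\<in>I. u i * x i b) y = (\<Sum>i\<in>I. u i * det_with_rows R m s t (x i) y)"
proof -
  have "det_with_rows R m s t (\<lambda>b. \<Sum>i\<in>I. u i * x i b) y
    = (\<Sum>b<m. \<Sum>i\<in>I. u i * (x i b * det_with_rows R m s t (\<lambda>b'. if b' = b then 1 else 0) y))"
    by (subst det_with_rows_expand[OF assms]) (simp add: sum_distrib_right mult.assoc)
  also have "\<dots> = (\<Sum>i\<in>I. u i * det_with_rows R m s t (x i) y)"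
    by (subst sum.swap) (simp add: det_with_rows_expand[OF assms, of R t "x _" y] sum_distrib_left)
  finally show ?thesis .
qed

lemma det_with_rows_same:
  assumes "s < m" "t < m" "s \<noteq> t"
  shows "det_with_rows R m s t x x = 0"
  using det_with_rows_swap[OF assms, of R x x] by simp

lemma det_with_rows_old:
  assumes "s < m" "t < m" "s \<noteq> t" "a < m" "a \<noteq> s" "a \<noteq> t"
  shows "det_with_rows R m s t (R a) y = 0"
  unfolding det_with_rows_def
  by (rule det_identical_rows[of _ m s a]) (use assms in auto)

text \<open>
  If the bracket of \<open>p\<close> and \<open>q\<close> is nonzero, then \<open>p\<close>, \<open>q\<close> and the fixed rows form a basis. Expanding
  \<open>e\<close> in this basis, the fixed rows contribute nothing to the determinant.
\<close>

lemma det_with_rows_combination: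
  assumes st: "s < m" "t < m" "s \<noteq> t" and nz: "det_with_rows R m s t p q \<noteq> 0"
  shows "\<exists>u v. \<forall>y. det_with_rows R m s t e y = u * det_with_rows R m s t p y + v * det_with_rows R m s t q y"
proof -
  let ?M = "mat m m (\<lambda>(a, b). if a = s then p b else if a = t then q b else R a b)"
  let ?f = "\<lambda>a. if a = s then p else if a = t then q else R a"
  have M: "?M \<in> carrier_mat m m" by simp
  have d: "det ?M \<noteq> 0" using nz by (simp add: det_with_rows_def)
  define w where "w = (1 / det ?M) \<cdot>\<^sub>v (transpose_mat (adj_mat ?M) *\<^sub>v vec m e)"
  have adjc: "adj_mat ?M \<in> carrier_mat m m" using adj_mat[OF M] by blast
  have w: "w \<in> carrier_vec m" using adjc by (simp add: w_def)
  have "transpose_mat ?M *\<^sub>v w = (1 / det ?M) \<cdot>\<^sub>v ((transpose_mat ?M * transpose_mat (adj_mat ?M)) *\<^sub>v vec m e)"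
    unfolding w_def using adjc
    by (subst mult_mat_vec[of _ m m]) (auto intro!: arg_cong[where f = "\<lambda>z. _ \<cdot>\<^sub>v z"] assoc_mult_mat_vec[symmetric])
  also have "transpose_mat ?M * transpose_mat (adj_mat ?M) = transpose_mat (adj_mat ?M * ?M)"
    by (rule transpose_mult[symmetric, OF adjc M])
  also have "\<dots> = det ?M \<cdot>\<^sub>m 1\<^sub>m m"
    by (subst adj_mat(3)[OF M]) auto
  also have "(1 / det ?M) \<cdot>\<^sub>v ((det ?M \<cdot>\<^sub>m 1\<^sub>m m) *\<^sub>v vec m e) = vec m e"
    using d by (intro eq_vecI) auto
  finally have eq: "transpose_mat ?M *\<^sub>v w = vec m e" .
  have e: "e b = (\<Sum>a<m. w $ a * ?f a b)" if "b < m" for b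
  proof -
    have "e b = (transpose_mat ?M *\<^sub>v w) $ b" using that eq by simp
    also have "\<dots> = (\<Sum>a<m. w $ a * ?f a b)"
      using that w by (auto simp: scalar_prod_def lessThan_atLeast0 mult.commute intro!: sum.cong)
    finally show ?thesis .
  qed
  have "det_with_rows R m s t e y = w $ s * det_with_rows R m s t p y + w $ t * det_with_rows R m s t q y" for y
  proof -
    have "det_with_rows R m s t e y = det_with_rows R m s t (\<lambda>b. \<Sum>a<m. w $ a * ?f a b) y"
      unfolding det_with_rows_def by (intro arg_cong[where f = det] cong_mat) (use e in auto)
    also have "\<dots> = (\<Sum>a<m. w $ a * det_with_rows R m s t (?f a) y)"
      by (rule det_with_rows_sum[OF st(1)])
    also have "\<dots> = (\<Sum>a\<in>{s, t}. w $ a * det_with_rows R m s t (?f a) y)"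
      by (rule sum.mono_neutral_right) (use st det_with_rows_old[OF st] in auto)
    also have "\<dots> = w $ s * det_with_rows R m s t p y + w $ t * det_with_rows R m s t q y"
      using st by auto
    finally show ?thesis .
  qed
  then show ?thesis by blast
qed

text \<open>
  Modulo the span of the fixed rows the four vectors \<open>p\<close>, \<open>q\<close>, \<open>q'\<close>, \<open>e\<close> live in a plane, where
  this is the usual relation between the six \<open>2 \<times> 2\<close> determinants. It holds by expanding \<open>e\<close> in a basis
  that consists of two of \<open>p\<close>, \<open>q\<close>, \<open>q'\<close> and the fixed rows; when no such basis exists, all
  terms vanish.
\<close>

lemma plucker_three_term:
  fixes R :: "nat \<Rightarrow> nat \<Rightarrow> real"
  assumes st: "s < m" "t < m" "s \<noteq> t"
  defines "D \<equiv> det_with_rows R m s t"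
  shows "D p q' * D e q = D p q * D e q' + D q q' * D e p"
proof -
  have swap: "D y x = - D x y" for x y
    unfolding D_def by (rule det_with_rows_swap[OF st])
  have same: "D x x = 0" for x
    unfolding D_def by (rule det_with_rows_same[OF st])
  have main: "D p q' * D e q = D p q * D e q' + D q q' * D e p" if nz: "D p q \<noteq> 0" for p q q'
  proof -
    obtain u v where e: "D e y = u * D p y + v * D q y" for y
      using det_with_rows_combination[OF st, of R p q e] nz unfolding D_def by blast
    have D: "D p p = 0" "D q q = 0" "D q p = - D p q"
      by (rule same same swap)+
    show ?thesis
      unfolding e D by (simp add: algebra_simps)
  qed
  consider "D p q \<noteq> 0" | "D p q' \<noteq> 0" | "D q q' \<noteq> 0"
    | "D p q = 0" "D p q' = 0" "D q q' = 0" by blast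
  then show ?thesis
  proof cases
    case 1 then show ?thesis by (rule main)
  next
    case 2
    have D: "D q' q = - D q q'" by (rule swap)
    show ?thesis using main[OF 2, of q] unfolding D by linarith
  next
    case 3
    have D: "D q p = - D p q" "D q' p = - D p q'" by (rule swap)+
    show ?thesis using main[OF 3, of p] unfolding D by linarith
  qed simp
qed

section \<open>Minors and the Whitney inequality\<close>

lemma totally_nonnegativeD:
  "totally_nonnegative X \<Longrightarrow> strict_mono_on {..<m} r \<Longrightarrow> strict_mono_on {..<m} c \<Longrightarrow>
    minor X m r c \<ge> 0"
  unfolding totally_nonnegative_def by blast

lemma minor_expand_row:
  assumes "s < Suc m"
  shows "minor X (Suc m) r c =
    (\<Sum>b<Suc m. X (r s) (c b) * ((-1) ^ (s + b) * minor X m (r \<circ> insert_index s) (c \<circ> insert_index b)))"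
proof -
  let ?A = "mat (Suc m) (Suc m) (\<lambda>(a, b). X (r a) (c b))"
  have "mat_delete ?A s b = mat m m (\<lambda>(a', b'). X ((r \<circ> insert_index s) a') ((c \<circ> insert_index b) b'))" for b
    by (intro eq_matI) (auto simp: mat_delete_def insert_index_def)
  then have "cofactor ?A s b = (-1) ^ (s + b) * minor X m (r \<circ> insert_index s) (c \<circ> insert_index b)" for b
    by (simp add: cofactor_def minor_def)
  moreover have "minor X (Suc m) r c = (\<Sum>b<Suc m. ?A $$ (s, b) * cofactor ?A s b)"
    unfolding minor_def by (rule laplace_expansion_row) (use assms in auto)
  ultimately show ?thesis using assms by simp
qed

lemma minor_transpose: "minor (\<lambda>i j. X j i) m c r = minor X m r c"
  unfolding minor_def
  by (subst det_transpose[symmetric, of _ m]) (auto intro!: arg_cong[where f = det] eq_matI)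

lemma minor_expand_column:
  assumes "t < Suc m"
  shows "minor X (Suc m) r c =
    (\<Sum>a<Suc m. X (r a) (c t) * ((-1) ^ (a + t) * minor X m (r \<circ> insert_index a) (c \<circ> insert_index t)))"
  using minor_expand_row[OF assms, of "\<lambda>i j. X j i" c r]
  by (simp add: minor_transpose[of X] add.commute)

text \<open>
  Composition with \<open>insert_index s\<close> deletes the index number \<open>s\<close>.
\<close>

lemma strict_mono_on_insert_index:
  assumes "strict_mono_on {..<Suc m} r"
  shows "strict_mono_on {..<m} (r \<circ> insert_index s)"
  using assms by (auto simp: strict_mono_on_def insert_index_def)

lemma strict_mono_on_upd:
  fixes r :: "nat \<Rightarrow> int"
  assumes "strict_mono_on {..<m} r" "\<And>a. a < t \<Longrightarrow> r a < x" "\<And>a. t < a \<Longrightarrow> a < m \<Longrightarrow> x < r a"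
  shows "strict_mono_on {..<m} (r(t := x))"
  using assms by (auto simp: strict_mono_on_def)

lemma minor_eq_det_with_rows:
  assumes "s \<noteq> t"
  shows "minor X m (r(s := x, t := y)) c =
    det_with_rows (\<lambda>a b. X (r a) (c b)) m s t (\<lambda>b. X x (c b)) (\<lambda>b. X y (c b))"
  unfolding minor_def det_with_rows_def
  by (intro arg_cong[where f = det] cong_mat) (use assms in auto)

lemma det_with_rows_unit_vector:
  assumes "s < Suc m" "s \<noteq> t" "k < Suc m"
  shows "det_with_rows (\<lambda>a b. X (r a) (c b)) (Suc m) s t (\<lambda>b. if b = k then 1 else 0) (\<lambda>b. X y (c b)) =
    (-1) ^ (s + k) * minor X m (r(t := y) \<circ> insert_index s) (c \<circ> insert_index k)"
proof -
  let ?A = "mat (Suc m) (Suc m) (\<lambda>(a, b). if a = s then if b = k then 1 else 0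
     else if a = t then X y (c b) else X (r a) (c b))"
  have "mat_delete ?A s k = mat m m (\<lambda>(a', b'). X ((r(t := y) \<circ> insert_index s) a') ((c \<circ> insert_index k) b'))"
    by (intro eq_matI) (auto simp: mat_delete_def insert_index_def)
  then have "cofactor ?A s k = (-1) ^ (s + k) * minor X m (r(t := y) \<circ> insert_index s) (c \<circ> insert_index k)"
    by (simp add: cofactor_def minor_def)
  moreover have "det ?A = (\<Sum>b<Suc m. ?A $$ (s, b) * cofactor ?A s b)"
    by (rule laplace_expansion_row) (use assms in auto)
  moreover have "\<dots> = (\<Sum>b<Suc m. if b = k then cofactor ?A s k else 0)"
    using assms by (intro sum.cong) auto
  ultimately show ?thesis using assms by (simp add: det_with_rows_def del: sum.lessThan_Suc)
qed

text \<open>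
  The three-term Pluecker relation for the two rows \<open>r s\<close>, \<open>r t\<close> of a minor, the row \<open>y\<close> of \<open>X\<close>, and the
  unit vector number \<open>k\<close>. A determinant with a row equal to the unit vector is, up to sign, a minor of
  one size less; the signs of the three terms agree.
\<close>

lemma minor_exchange:
  assumes "s < Suc m" "t < Suc m" "s \<noteq> t" "k < Suc m"
  shows "minor X (Suc m) r c * minor X m (r(t := y) \<circ> insert_index s) (c \<circ> insert_index k) =
    minor X (Suc m) (r(t := y)) c * minor X m (r \<circ> insert_index s) (c \<circ> insert_index k) +
    minor X (Suc m) (r(s := y)) c * minor X m (r(t := r s) \<circ> insert_index s) (c \<circ> insert_index k)"
proof -
  define D where "D = det_with_rows (\<lambda>a b. X (r a) (c b)) (Suc m) s t"
  define row where "row x = (\<lambda>b. X x (c b))" for x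
  define e where "e = (\<lambda>b. if b = k then 1 else (0::real))"
  have D: "minor X (Suc m) (r(s := x, t := z)) c = D (row x) (row z)" for x z
    unfolding D_def row_def by (rule minor_eq_det_with_rows[OF assms(3)])
  have E: "D e (row z) = (-1) ^ (s + k) * minor X m (r(t := z) \<circ> insert_index s) (c \<circ> insert_index k)" for z
    unfolding D_def row_def e_def by (rule det_with_rows_unit_vector) (use assms in auto)
  have "D (row (r s)) (row (r t)) * D e (row y) =
    D (row (r s)) (row y) * D e (row (r t)) + D (row y) (row (r t)) * D e (row (r s))"
    unfolding D_def by (rule plucker_three_term) (use assms in auto)
  then have "(-1) ^ (s + k) * (minor X (Suc m) r c * minor X m (r(t := y) \<circ> insert_index s) (c \<circ> insert_index k)) =
    (-1) ^ (s + k) * (minor X (Suc m) (r(t := y)) c * minor X m (r \<circ> insert_index s) (c \<circ> insert_index k) +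
      minor X (Suc m) (r(s := y)) c * minor X m (r(t := r s) \<circ> insert_index s) (c \<circ> insert_index k))"
    unfolding E D[symmetric] using assms(3)
    by (simp add: fun_upd_twist[of s t] fun_upd_idem algebra_simps)
  then show ?thesis by simp
qed

lemma totally_nonnegative_entry:
  assumes "totally_nonnegative X"
  shows "X i j \<ge> 0"
proof -
  have "0 \<le> minor X 1 (\<lambda>_. i) (\<lambda>_. j)"
    by (rule totally_nonnegativeD[OF assms]) (auto simp: strict_mono_on_def)
  then show ?thesis by (simp add: minor_def det_single)
qed

text \<open>
  The determinantal content of Whitney's elimination: the ratio of the minors using row \<open>i + 1\<close> and
  row \<open>i\<close> is at least the ratio of the entries of these rows in their common leading column \<open>j\<close>.
  
  The induction is on the number \<open>t\<close> of rows of the minor above row \<open>i + 1\<close>. Suppose that there is none. If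
  all columns lie to the right of \<open>j\<close>, the difference of the two sides is itself a minor, namely the one
  enlarged by row \<open>i\<close> and column \<open>j\<close>, since column \<open>j\<close> of that minor has at most two nonzero entries;
  otherwise the first column makes both sides equal. If there are rows above, delete the last of them, together with
  a column \<open>k\<close> chosen such that the smaller minor with row \<open>i\<close> stays positive. All terms of the exchange
  relation are nonnegative, so the ratio does not increase when passing to the smaller minors.
  Deleting the adjacent row is convenient because every row set that then occurs is already sorted.
\<close>

lemma whitney_minor_inequality:
  assumes tnn: "totally_nonnegative X"
    and left: "\<And>k l. k \<ge> i \<Longrightarrow> l < j \<Longrightarrow> X k l = 0"
    and below: "\<And>k. k > i + 1 \<Longrightarrow> X k j = 0"
  shows "strict_mono_on {..<m} r \<Longrightarrow> strict_mono_on {..<m} c \<Longrightarrow> t < m \<Longrightarrow> r t = i + 1 \<Longrightarrow>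
    (\<And>a. a < m \<Longrightarrow> r a \<noteq> i) \<Longrightarrow>
    X (i + 1) j * minor X m (r(t := i)) c \<le> X i j * minor X m r c"
proof (induction t arbitrary: m r c)
  case 0
  then obtain m' where m: "m = Suc m'" by (cases m) auto
  have r: "r a > i + 1" if "0 < a" "a < m" for a
    using strict_mono_onD[OF 0(1), of 0 a] that 0(4) by simp
  have ri: "r a > i" if "a < m" for a
    using r[of a] 0(4) that by (cases "a = 0") auto
  consider "c 0 < j" | "c 0 = j" | "c 0 > j" by linarith
  then show ?case
  proof cases
    case 1
    then have "X (r a) (c 0) = 0" if "a < m" for a
      using ri[OF that] by (intro left) auto
    moreover have "X i (c 0) = 0" using 1 left by simp
    ultimately have zero: "minor X m r c = 0" "minor X m (r(0 := i)) c = 0"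
      unfolding m by (auto simp: minor_expand_column[of 0] simp del: sum.lessThan_Suc intro!: sum.neutral)
    show ?thesis unfolding zero by simp
  next
    case 2
    have z: "X (r a) (c 0) = 0" if "0 < a" "a < m" for a
      using r[OF that] 2 below by auto
    have e: "minor X (Suc m') r' c = X (r' 0) (c 0) * minor X m' (r \<circ> insert_index 0) (c \<circ> insert_index 0)"
      if "\<And>a. a > 0 \<Longrightarrow> r' a = r a" for r'
    proof -
      have "r' \<circ> insert_index 0 = r \<circ> insert_index 0" using that by (auto simp: insert_index_def)
      then have "minor X (Suc m') r' c =
        X (r' 0) (c 0) * minor X m' (r \<circ> insert_index 0) (c \<circ> insert_index 0) + 
        (\<Sum>a\<in>{..<Suc m'} - {0}. X (r' a) (c 0) * ((-1) ^ (a + 0) * minor X m' (r' \<circ> insert_index a) (c \<circ> insert_index 0)))"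
        by (subst minor_expand_column[of 0]) (simp_all add: sum.remove[of _ 0] del: sum.lessThan_Suc)
      also have "(\<Sum>a\<in>{..<Suc m'} - {0}. X (r' a) (c 0) * ((-1) ^ (a + 0) * minor X m' (r' \<circ> insert_index a) (c \<circ> insert_index 0))) = 0"
        by (rule sum.neutral) (use that z m in auto)
      finally show ?thesis by (simp only: add_0_right)
    qed
    have "minor X m r c = X (i + 1) j * minor X m' (r \<circ> insert_index 0) (c \<circ> insert_index 0)"
      using e[of r] 2 0(4) m by simp
    moreover have "minor X m (r(0 := i)) c = X i j * minor X m' (r \<circ> insert_index 0) (c \<circ> insert_index 0)"
      using e[of "r(0 := i)"] 2 unfolding m fun_upd_same by simp
    ultimately show ?thesis by (simp only: mult.left_commute order_refl)
  next
    case 3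
    define r' c' where "r' = (\<lambda>a. case a of 0 \<Rightarrow> i | Suc a \<Rightarrow> r a)"
      and "c' = (\<lambda>a. case a of 0 \<Rightarrow> j | Suc a \<Rightarrow> c a)"
    have c0: "c 0 \<le> c a" if "a < m" for a
      using strict_mono_onD[OF 0(2), of 0 a] that by (cases "a = 0") auto
    have "strict_mono_on {..<Suc m} r'"
      using strict_mono_onD[OF 0(1)] ri by (auto simp: strict_mono_on_def r'_def split: nat.splits)
    moreover have "strict_mono_on {..<Suc m} c'"
      using strict_mono_onD[OF 0(2)] less_le_trans[OF 3 c0] by (auto simp: strict_mono_on_def c'_def split: nat.splits)
    ultimately have "0 \<le> minor X (Suc m) r' c'"
      by (rule totally_nonnegativeD[OF tnn])
    also have "\<dots> = (\<Sum>a<Suc m. X (r' a) (c' 0) * ((-1) ^ (a + 0) * minor X m (r' \<circ> insert_index a) (c' \<circ> insert_index 0)))"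
      by (rule minor_expand_column) simp
    also have "\<dots> = (\<Sum>a\<in>{0, 1}. X (r' a) (c' 0) * ((-1) ^ (a + 0) * minor X m (r' \<circ> insert_index a) (c' \<circ> insert_index 0)))"
    proof (rule sum.mono_neutral_right)
      have "X (r' a) (c' 0) = 0" if "a \<in> {..<Suc m} - {0, 1}" for a
        using that r[of "a - 1"] below by (cases a) (auto simp: r'_def c'_def)
      then show "\<forall>a\<in>{..<Suc m} - {0, 1}. X (r' a) (c' 0) * ((- 1) ^ (a + 0) * minor X m (r' \<circ> insert_index a) (c' \<circ> insert_index 0)) = 0"
        by simp
    qed (use m in auto)
    also have "\<dots> = X i j * minor X m (r' \<circ> insert_index 0) (c' \<circ> insert_index 0) - X (i + 1) j * minor X m (r' \<circ> insert_index 1) (c' \<circ> insert_index 0)"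
      using 0(4) by (simp add: r'_def c'_def)
    also have "r' \<circ> insert_index 0 = r" by (auto simp: r'_def insert_index_def)
    also have "c' \<circ> insert_index 0 = c" by (auto simp: c'_def insert_index_def)
    also have "r' \<circ> insert_index 1 = r(0 := i)" by (auto simp: r'_def insert_index_def split: nat.splits)
    finally show ?thesis by simp
  qed
next
  case (Suc t)
  then obtain m' where m: "m = Suc m'" by (cases m) auto
  have mono: "r a < r b" if "a < b" "b < m" for a b
    using strict_mono_onD[OF Suc.prems(1)] that by auto
  have rt: "r t < i"
    using mono[of t "Suc t"] Suc.prems(3,4) Suc.prems(5)[of t] by linarith
  have low: "r a < i" if "a \<le> t" for a
    using mono[of a t] rt that Suc.prems(3) by (cases "a = t") auto
  have high: "r a > i + 1" if "a > Suc t" "a < m" for a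
    using mono[of "Suc t" a] that Suc.prems(4) by simp
  have mono_i: "strict_mono_on {..<m} (r(Suc t := i))"
    by (rule strict_mono_on_upd[OF Suc.prems(1)]) (use low in simp, use high in force)
  show ?case
  proof (cases "minor X m (r(Suc t := i)) c = 0")
    case True
    have "0 \<le> X i j * minor X m r c"
    proof -
      have "minor X m r c \<ge> 0" by (rule totally_nonnegativeD[OF tnn Suc.prems(1,2)])
      moreover have "X i j \<ge> 0" by (rule totally_nonnegative_entry[OF tnn])
      ultimately show ?thesis by simp
    qed
    then show ?thesis unfolding True by simp
  next
    case False
    have t: "t < Suc m'" using Suc.prems(3) m by simp
    \<comment> \<open>The Laplace expansion along row \<open>t\<close> is nonzero, hence so is one of its terms.\<close>
    obtain k where k: "k < Suc m'" and
      nz: "minor X m' (r(Suc t := i) \<circ> insert_index t) (c \<circ> insert_index k) \<noteq> 0"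
    proof (rule ccontr)
      assume *: "\<not> thesis"
      have z: "minor X m' (r(Suc t := i) \<circ> insert_index t) (c \<circ> insert_index k) = 0" if "k < Suc m'" for k
        using * \<open>\<And>k. k < Suc m' \<Longrightarrow> _ \<Longrightarrow> thesis\<close>[OF that] by blast
      have "minor X m (r(Suc t := i)) c = 0"
        unfolding m minor_expand_row[OF t] by (rule sum.neutral) (use z in auto)
      with False show False by simp
    qed
    define c' where "c' = c \<circ> insert_index k"
    define r' where "r' = r \<circ> insert_index t"
    have c': "strict_mono_on {..<m'} c'"
      unfolding c'_def by (rule strict_mono_on_insert_index) (use Suc.prems(2) m in simp)
    have r': "strict_mono_on {..<m'} r'"
      unfolding r'_def by (rule strict_mono_on_insert_index) (use Suc.prems(1) m in simp)
    have r'i: "r(Suc t := i) \<circ> insert_index t = r'(t := i)"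
      by (auto simp: r'_def insert_index_def)
    have pos: "minor X m' (r'(t := i)) c' > 0"
    proof -
      have "strict_mono_on {..<m'} (r'(t := i))"
        unfolding r'i[symmetric] by (rule strict_mono_on_insert_index) (use mono_i m in simp)
      then have "minor X m' (r'(t := i)) c' \<ge> 0"
        by (rule totally_nonnegativeD[OF tnn]) (rule c')
      then show ?thesis using nz by (simp add: c'_def r'i)
    qed
    have IH: "X (i + 1) j * minor X m' (r'(t := i)) c' \<le> X i j * minor X m' r' c'"
    proof (rule Suc.IH[OF r' c'])
      show "t < m'" using Suc.prems(3) m by simp
      show "r' t = i + 1" using Suc.prems(4) by (simp add: r'_def insert_index_def)
      show "r' a \<noteq> i" if "a < m'" for a
        using Suc.prems(5) that m by (simp add: r'_def insert_index_def)
    qed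
    have a: "minor X m (r(t := i)) c \<ge> 0"
    proof (rule totally_nonnegativeD[OF tnn _ Suc.prems(2)])
      show "strict_mono_on {..<m} (r(t := i))"
      proof (rule strict_mono_on_upd[OF Suc.prems(1)])
        show "i < r a" if "t < a" "a < m" for a
          using high[of a] that Suc.prems(4) by (cases "a = Suc t") auto
      qed (use low in simp)
    qed
    have b: "minor X m' (r(Suc t := r t) \<circ> insert_index t) c' \<ge> 0"
    proof (rule totally_nonnegativeD[OF tnn _ c'])
      have "strict_mono_on {..<m'} (r \<circ> insert_index (Suc t))"
        by (rule strict_mono_on_insert_index) (use Suc.prems(1) m in simp)
      also have "r \<circ> insert_index (Suc t) = r(Suc t := r t) \<circ> insert_index t"
        by (auto simp: insert_index_def less_Suc_eq)
      finally show "strict_mono_on {..<m'} (r(Suc t := r t) \<circ> insert_index t)" .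
    qed
    have "X (i + 1) j * minor X m (r(Suc t := i)) c * minor X m' (r'(t := i)) c'
      = minor X m (r(Suc t := i)) c * (X (i + 1) j * minor X m' (r'(t := i)) c')"
      by simp
    also have "\<dots> \<le> minor X m (r(Suc t := i)) c * (X i j * minor X m' r' c')"
      by (rule mult_left_mono[OF IH totally_nonnegativeD[OF tnn mono_i Suc.prems(2)]])
    also have "\<dots> \<le> X i j * (minor X m (r(Suc t := i)) c * minor X m' r' c'
       + minor X m (r(t := i)) c * minor X m' (r(Suc t := r t) \<circ> insert_index t) c')"
      using a b totally_nonnegative_entry[OF tnn, of i j] by (simp add: distrib_left)
    also have "\<dots> = X i j * (minor X m r c * minor X m' (r'(t := i)) c')"
      using minor_exchange[of t m' "Suc t" k X r c i] Suc.prems(3) k m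
      by (simp add: r'i c'_def r'_def)
    finally have "X (i + 1) j * minor X m (r(Suc t := i)) c * minor X m' (r'(t := i)) c'
      \<le> X i j * minor X m r c * minor X m' (r'(t := i)) c'" by (simp add: mult.assoc)
    then show ?thesis by (rule mult_right_le_imp_le[OF _ pos])
  qed
qed


section \<open>Operations that preserve total nonnegativity\<close>

lemma minor_row_add:
  assumes t: "t < m" and inj: "\<And>a. a < m \<Longrightarrow> a \<noteq> t \<Longrightarrow> r a \<noteq> r t"
  shows "minor (X(r t := \<lambda>j. X (r t) j + u * X l j)) m r c =
    minor X m r c + u * minor X m (r(t := l)) c"
proof -
  obtain m' where m: "m = Suc m'" using t by (cases m) auto
  let ?Y = "X(r t := \<lambda>j. X (r t) j + u * X l j)"
  have Y: "minor ?Y m' (r \<circ> insert_index t) d = minor X m' (r \<circ> insert_index t) d" for d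
    unfolding minor_def
    by (intro arg_cong[where f = det] cong_mat) (use inj in \<open>auto simp: m insert_index_def\<close>)
  have r: "r(t := l) \<circ> insert_index t = r \<circ> insert_index t"
    by (auto simp: insert_index_def)
  have tm: "t < Suc m'" using t m by simp
  show ?thesis
    unfolding m minor_expand_row[OF tm] Y r fun_upd_same sum_distrib_left sum.distrib[symmetric]
    by (rule sum.cong) (simp_all add: algebra_simps)
qed

lemma minor_cong_matrix:
  assumes "\<And>a b. a < m \<Longrightarrow> b < m \<Longrightarrow> X (r a) (c b) = Y (r a) (c b)"
  shows "minor X m r c = minor Y m r c"
  unfolding minor_def by (intro arg_cong[where f = det] cong_mat) (use assms in auto)

lemma minor_repeated_row:
  assumes "s < m" "t < m" "s \<noteq> t" "r s = r t"
  shows "minor X m r c = 0"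
  unfolding minor_def by (rule det_identical_rows[of _ m s t]) (use assms in auto)

text \<open>
  A minor that involves row \<open>k\<close> changes by \<open>u\<close> times the minor in which row \<open>l\<close> replaces row \<open>k\<close>; the latter
  vanishes if row \<open>l\<close> was already present. So only the case where row \<open>l\<close> is absent needs an argument.
\<close>

lemma totally_nonnegative_row_update:
  assumes tnn: "totally_nonnegative X"
    and ineq: "\<And>m r c t. strict_mono_on {..<m} r \<Longrightarrow> strict_mono_on {..<m} c \<Longrightarrow> t < m \<Longrightarrow> r t = k \<Longrightarrow>
      (\<And>a. a < m \<Longrightarrow> r a \<noteq> l) \<Longrightarrow> 0 \<le> minor X m r c + u * minor X m (r(t := l)) c"
    and "k \<noteq> l"
  shows "totally_nonnegative (X(k := \<lambda>j. X k j + u * X l j))"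
  unfolding totally_nonnegative_def
proof (intro allI impI)
  fix m :: nat and r c :: "nat \<Rightarrow> int"
  assume r: "strict_mono_on {..<m} r" and c: "strict_mono_on {..<m} c"
  let ?Y = "X(k := \<lambda>j. X k j + u * X l j)"
  note pos = totally_nonnegativeD[OF tnn r c]
  show "0 \<le> minor ?Y m r c"
  proof (cases "\<exists>t<m. r t = k")
    case True
    then obtain t where t: "t < m" "r t = k" by blast
    have inj: "r a \<noteq> r t" if "a < m" "a \<noteq> t" for a
      using strict_mono_onD[OF r, of a t] strict_mono_onD[OF r, of t a] that t(1)
      by (cases "a < t") auto
    have "minor (X(r t := \<lambda>j. X (r t) j + u * X l j)) m r c =
      minor X m r c + u * minor X m (r(t := l)) c"
      by (rule minor_row_add[OF t(1)]) (rule inj)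
    then have eq: "minor ?Y m r c = minor X m r c + u * minor X m (r(t := l)) c"
      unfolding t(2) .
    show ?thesis
    proof (cases "\<exists>s<m. r s = l")
      case True
      then obtain s where s: "s < m" "r s = l" by blast
      have "minor X m (r(t := l)) c = 0"
        by (rule minor_repeated_row[of s m t]) (use s t \<open>k \<noteq> l\<close> in auto)
      then show ?thesis using pos unfolding eq by simp
    next
      case False
      then show ?thesis unfolding eq by (intro ineq r c t) auto
    qed
  next
    case False
    then have "minor ?Y m r c = minor X m r c"
      by (intro minor_cong_matrix) auto
    then show ?thesis using pos by simp
  qed
qed

text \<open>
  Row \<open>k + 1\<close> can take the place of row \<open>k\<close> without disturbing the order of the rows.
\<close>

lemma totally_nonnegative_add_next_row:
  assumes tnn: "totally_nonnegative X" and "u \<ge> 0"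
  shows "totally_nonnegative (X(k := \<lambda>j. X k j + u * X (k + 1) j))"
proof (rule totally_nonnegative_row_update[OF tnn])
  fix m t :: nat and r c :: "nat \<Rightarrow> int"
  assume r: "strict_mono_on {..<m} r" and c: "strict_mono_on {..<m} c"
    and t: "t < m" "r t = k" and no: "\<And>a. a < m \<Longrightarrow> r a \<noteq> k + 1"
  have "strict_mono_on {..<m} (r(t := k + 1))"
  proof (rule strict_mono_on_upd[OF r])
    show "r a < k + 1" if "a < t" for a
      using strict_mono_onD[OF r, of a t] that t by simp
    show "k + 1 < r a" if "t < a" "a < m" for a
      using strict_mono_onD[OF r, of t a] that t no[of a] by simp
  qed
  then have "0 \<le> minor X m (r(t := k + 1)) c"
    by (rule totally_nonnegativeD[OF tnn _ c])
  then show "0 \<le> minor X m r c + u * minor X m (r(t := k + 1)) c"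
    using totally_nonnegativeD[OF tnn r c] \<open>u \<ge> 0\<close> by (intro add_nonneg_nonneg mult_nonneg_nonneg)
qed simp

lemma totally_nonnegative_whitney_step:
  assumes tnn: "totally_nonnegative X" and pivot: "X i j > 0"
    and left: "\<And>k l. k \<ge> i \<Longrightarrow> l < j \<Longrightarrow> X k l = 0"
    and below: "\<And>k. k > i + 1 \<Longrightarrow> X k j = 0"
  shows "totally_nonnegative (X(i + 1 := \<lambda>l. X (i + 1) l + (- X (i + 1) j / X i j) * X i l))"
proof (rule totally_nonnegative_row_update[OF tnn])
  fix m t :: nat and r c :: "nat \<Rightarrow> int"
  assume *: "strict_mono_on {..<m} r" "strict_mono_on {..<m} c" "t < m" "r t = i + 1"
    "\<And>a. a < m \<Longrightarrow> r a \<noteq> i"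
  have "X (i + 1) j * minor X m (r(t := i)) c \<le> X i j * minor X m r c"
    using whitney_minor_inequality[OF tnn, of i j m r c t] left below * by blast
  then show "0 \<le> minor X m r c + (- X (i + 1) j / X i j) * minor X m (r(t := i)) c"
    using pivot by (simp add: field_simps del: fun_upd_apply)
qed simp

text \<open>
  A minor sees finitely many rows. This reduces an operation on infinitely many rows to
  finitely many operations on one row each.
\<close>

lemma totally_nonnegative_local:
  assumes "\<And>N. \<exists>Y. totally_nonnegative Y \<and> (\<forall>i j. \<bar>i\<bar> \<le> N \<longrightarrow> Y i j = X i j)"
  shows "totally_nonnegative X"
  unfolding totally_nonnegative_def
proof (intro allI impI)
  fix m :: nat and r c :: "nat \<Rightarrow> int"
  assume r: "strict_mono_on {..<m} r" and c: "strict_mono_on {..<m} c"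
  obtain Y where Y: "totally_nonnegative Y"
    "\<forall>i j. \<bar>i\<bar> \<le> (\<Sum>a<m. \<bar>r a\<bar>) \<longrightarrow> Y i j = X i j"
    using assms by blast
  have "\<bar>r a\<bar> \<le> (\<Sum>a<m. \<bar>r a\<bar>)" if "a < m" for a
    by (rule member_le_sum[of a "{..<m}" "\<lambda>a. \<bar>r a\<bar>"]) (use that in auto)
  then have "minor X m r c = minor Y m r c"
    by (intro minor_cong_matrix) (use Y(2) in auto)
  then show "0 \<le> minor X m r c"
    using totally_nonnegativeD[OF Y(1) r c] by simp
qed

text \<open>
  Left multiplication by a unit upper bidiagonal nonnegative matrix. The rows are changed in increasing
  order, because then the row \<open>k + 1\<close> that is added to row \<open>k\<close> is still the original one.
\<close>

lemma totally_nonnegative_bidiagonal: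
  assumes tnn: "totally_nonnegative X" and u: "\<And>i. u i \<ge> 0"
  shows "totally_nonnegative (\<lambda>i j. X i j + u i * X (i + 1) j)"
proof (rule totally_nonnegative_local)
  fix N :: int
  define Y where "Y k = (\<lambda>i j. if - \<bar>N\<bar> \<le> i \<and> i < k then X i j + u i * X (i + 1) j else X i j)" for k
  have "totally_nonnegative (Y k)" if "k \<ge> - \<bar>N\<bar>" for k
    using that
  proof (induction k rule: int_ge_induct)
    case base
    have "Y (- \<bar>N\<bar>) = X" by (intro ext) (auto simp: Y_def)
    then show ?case using tnn by simp
  next
    case (step k)
    have "Y (k + 1) = (Y k)(k := \<lambda>j. Y k k j + u k * Y k (k + 1) j)"
      using step.hyps by (intro ext) (auto simp: Y_def)
    then show ?case
      by (simp only: totally_nonnegative_add_next_row[OF step.IH u])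
  qed
  then have "totally_nonnegative (Y (\<bar>N\<bar> + 1))" by simp
  then show "\<exists>Y. totally_nonnegative Y \<and>
    (\<forall>i j. \<bar>i\<bar> \<le> N \<longrightarrow> Y i j = X i j + u i * X (i + 1) j)"
    by (intro exI[of _ "Y (\<bar>N\<bar> + 1)"]) (auto simp: Y_def)
qed

text \<open>
  Whitney's elimination performed at all rows in \<open>P\<close>, where \<open>p r\<close> is the leading column in which row
  \<open>r\<close> is cleared by row \<open>r - 1\<close>. No two rows of \<open>P\<close> are adjacent, so the single eliminations neither change each
  other's pivot rows nor spoil the zeros that each of them relies on.
\<close>

lemma totally_nonnegative_whitney:
  assumes tnn: "totally_nonnegative X"
    and sparse: "\<And>r. r \<in> P \<Longrightarrow> r - 1 \<notin> P"
    and pivot: "\<And>r. r \<in> P \<Longrightarrow> X (r - 1) (p r) > 0"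
    and left: "\<And>r k l. r \<in> P \<Longrightarrow> k \<ge> r - 1 \<Longrightarrow> l < p r \<Longrightarrow> X k l = 0"
    and below: "\<And>r k. r \<in> P \<Longrightarrow> k > r \<Longrightarrow> X k (p r) = 0"
  shows "totally_nonnegative (\<lambda>r l.
    if r \<in> P then X r l + (- X r (p r) / X (r - 1) (p r)) * X (r - 1) l else X r l)"
    (is "totally_nonnegative ?Z")
proof (rule totally_nonnegative_local)
  fix N :: int
  define Y where "Y Q = (\<lambda>r l. if r \<in> Q then ?Z r l else X r l)" for Q
  have "totally_nonnegative (Y Q)" if "finite Q" "Q \<subseteq> P" for Q
    using that
  proof (induction Q rule: finite_induct)
    case empty
    then show ?case using tnn by (simp add: Y_def)
  next
    case (insert r Q)
    have old: "Y Q r = X r" "Y Q (r - 1) = X (r - 1)"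
      using insert sparse by (auto simp: Y_def)
    have r: "r \<in> P" using insert by simp
    have "totally_nonnegative ((Y Q)(r - 1 + 1 :=
      \<lambda>l. Y Q (r - 1 + 1) l + (- Y Q (r - 1 + 1) (p r) / Y Q (r - 1) (p r)) * Y Q (r - 1) l))"
    proof (rule totally_nonnegative_whitney_step)
      show "totally_nonnegative (Y Q)" using insert by blast
      show "Y Q (r - 1) (p r) > 0" using pivot[OF r] by (simp add: old)
      show "Y Q k l = 0" if "k \<ge> r - 1" "l < p r" for k l
      proof (cases "k = r - 1")
        case True
        then show ?thesis using left[OF r that] by (simp add: old)
      next
        case False
        then show ?thesis using left[OF r _ that(2), of k] left[OF r _ that(2), of "k - 1"] that(1)
          by (simp add: Y_def)
      qed
      show "Y Q k (p r) = 0" if "k > r - 1 + 1" for k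
      proof (cases "k \<in> Q")
        case True
        then have "k \<in> P" "k - 1 \<noteq> r" using insert sparse[of k] r by auto
        then show ?thesis using below[OF r, of k] below[OF r, of "k - 1"] that
          by (simp add: Y_def)
      next
        case False
        then show ?thesis using below[OF r, of k] that by (simp add: Y_def)
      qed
    qed
    moreover have "(Y Q)(r - 1 + 1 :=
      \<lambda>l. Y Q (r - 1 + 1) l + (- Y Q (r - 1 + 1) (p r) / Y Q (r - 1) (p r)) * Y Q (r - 1) l) = Y (insert r Q)"
      unfolding diff_add_cancel old using r by (intro ext) (auto simp: Y_def)
    ultimately show ?case by simp
  qed
  then have "totally_nonnegative (Y (P \<inter> {- \<bar>N\<bar>..\<bar>N\<bar>}))" by simp
  then show "\<exists>Y. totally_nonnegative Y \<and> (\<forall>i j. \<bar>i\<bar> \<le> N \<longrightarrow> Y i j = ?Z i j)"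
    by (intro exI[of _ "Y (P \<inter> {- \<bar>N\<bar>..\<bar>N\<bar>})"]) (auto simp: Y_def)
qed

text \<open>
  Reversal of both the rows and the columns. It is multiplicative, preserves total nonnegativity, exchanges
  upper with lower triangular matrices and the two families of Chevalley generators.
\<close>

definition reverse_bimatrix :: "bimatrix \<Rightarrow> bimatrix" where
  "reverse_bimatrix X = (\<lambda>i j. X (- i) (- j))"

lemma minor_reverse:
  "minor X m (\<lambda>a. r (m - 1 - a)) (\<lambda>b. c (m - 1 - b)) = minor X m r c"
proof -
  define p where "p a = (if a < m then m - 1 - a else a)" for a
  have p: "p permutes {0..<m}"
    by (rule bij_imp_permutes, rule bij_betw_byWitness[where f' = p]) (auto simp: p_def)
  \<comment> \<open>The same sign appears once for the rows and once for the columns, and cancels.\<close>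
  have rows: "minor X m (\<lambda>a. r (m - 1 - a)) c = signof p * minor X m r c" for X :: bimatrix and r c
  proof -
    have "mat m m (\<lambda>(a, b). X (r (m - 1 - a)) (c b)) =
      mat m m (\<lambda>(a, b). mat m m (\<lambda>(a, b). X (r a) (c b)) $$ (p a, b))"
      by (intro eq_matI) (auto simp: p_def)
    then show ?thesis
      unfolding minor_def by (simp add: det_permute_rows[OF _ p])
  qed
  have "minor X m (\<lambda>a. r (m - 1 - a)) (\<lambda>b. c (m - 1 - b)) =
    signof p * minor X m r (\<lambda>b. c (m - 1 - b))"
    by (rule rows)
  also have "minor X m r (\<lambda>b. c (m - 1 - b)) = minor (\<lambda>i j. X j i) m (\<lambda>b. c (m - 1 - b)) r"
    by (rule minor_transpose[symmetric])
  also have "\<dots> = signof p * minor (\<lambda>i j. X j i) m c r"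
    by (rule rows)
  also have "minor (\<lambda>i j. X j i) m c r = minor X m r c"
    by (rule minor_transpose)
  also have "signof p * (signof p * minor X m r c) = signof p * signof p * minor X m r c"
    by simp
  also have "signof p * signof p = (1::real)"
    by (simp add: sign_def)
  finally show ?thesis by simp
qed

lemma totally_nonnegative_reverse:
  assumes "totally_nonnegative X"
  shows "totally_nonnegative (reverse_bimatrix X)"
  unfolding totally_nonnegative_def
proof (intro allI impI)
  fix m :: nat and r c :: "nat \<Rightarrow> int"
  assume r: "strict_mono_on {..<m} r" and c: "strict_mono_on {..<m} c"
  have mono: "strict_mono_on {..<m} (\<lambda>a. - r (m - 1 - a))" if "strict_mono_on {..<m} r" for r :: "nat \<Rightarrow> int"
    unfolding strict_mono_on_def
    by (auto intro!: strict_mono_onD[OF that])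
  have "0 \<le> minor X m (\<lambda>a. - r (m - 1 - a)) (\<lambda>a. - c (m - 1 - a))"
    by (rule totally_nonnegativeD[OF assms mono[OF r] mono[OF c]])
  also have "\<dots> = minor X m (\<lambda>a. - r a) (\<lambda>a. - c a)"
    by (rule minor_reverse[of X m "\<lambda>a. - r a" "\<lambda>a. - c a"])
  finally show "0 \<le> minor (reverse_bimatrix X) m r c"
    by (simp add: minor_def reverse_bimatrix_def)
qed

section \<open>Periodic banded matrices\<close>

text \<open>
  The matrix product. The sum ranges over the support of a row of the left factor, so it is the true product
  whenever that row is finitely supported.
\<close>

definition bmul :: "bimatrix \<Rightarrow> bimatrix \<Rightarrow> bimatrix" where
  "bmul X Y = (\<lambda>i j. \<Sum>k | X i k \<noteq> 0. X i k * Y k j)"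

definition id_bimatrix :: bimatrix where
  "id_bimatrix = (\<lambda>i j. if i = j then 1 else 0)"

definition row_finite :: "bimatrix \<Rightarrow> bool" where
  "row_finite X \<longleftrightarrow> (\<forall>i. finite {k. X i k \<noteq> 0})"

text \<open>
  The periodic banded matrices, which are the unfoldings of all Laurent polynomial matrices.
\<close>

definition loop_matrix :: "nat \<Rightarrow> bimatrix \<Rightarrow> bool" where
  "loop_matrix n X \<longleftrightarrow> (\<forall>i j. X (i + int n) (j + int n) = X i j) \<and>
    (\<exists>N. \<forall>i j. X i j \<noteq> 0 \<longrightarrow> \<bar>j - i\<bar> \<le> N)"

text \<open>
  The inverse is required to be banded as well; this is what the monomial determinant amounts to.
\<close>

definition loop_group :: "nat \<Rightarrow> bimatrix set" where
  "loop_group n = {X. loop_matrix n X \<and>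
    (\<exists>Y. loop_matrix n Y \<and> bmul X Y = id_bimatrix \<and> bmul Y X = id_bimatrix)}"

lemma bmul_eq_sum:
  assumes "finite K" "\<And>k. X i k \<noteq> 0 \<Longrightarrow> k \<in> K"
  shows "bmul X Y i j = (\<Sum>k\<in>K. X i k * Y k j)"
  unfolding bmul_def by (rule sum.mono_neutral_left) (use assms in auto)

lemma bmul_nonzero:
  assumes "bmul X Y i j \<noteq> 0"
  obtains k where "X i k \<noteq> 0" "Y k j \<noteq> 0"
proof -
  have "(\<Sum>k | X i k \<noteq> 0. X i k * Y k j) \<noteq> 0" using assms by (simp add: bmul_def)
  then obtain k where "X i k * Y k j \<noteq> 0" by (meson sum.not_neutral_contains_not_neutral)
  then show ?thesis using that by auto
qed

lemma bmul_assoc: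
  assumes "row_finite X" "row_finite Y"
  shows "bmul (bmul X Y) Z = bmul X (bmul Y Z)"
proof (intro ext)
  fix i j
  define I where "I = {l. X i l \<noteq> 0}"
  define K where "K = (\<Union>l\<in>I. {k. Y l k \<noteq> 0})"
  have fin: "finite I" "finite K" using assms by (auto simp: I_def K_def row_finite_def)
  have XY: "bmul X Y i k = (\<Sum>l\<in>I. X i l * Y l k)" for k
    by (simp add: bmul_def I_def)
  have YZ: "bmul Y Z l j = (\<Sum>k\<in>K. Y l k * Z k j)" if "l \<in> I" for l
    by (rule bmul_eq_sum) (use fin that in \<open>auto simp: K_def\<close>)
  have "bmul (bmul X Y) Z i j = (\<Sum>k\<in>K. bmul X Y i k * Z k j)"
    by (rule bmul_eq_sum[OF fin(2)]) (auto simp: K_def I_def elim: bmul_nonzero)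
  also have "\<dots> = (\<Sum>k\<in>K. \<Sum>l\<in>I. X i l * (Y l k * Z k j))"
    by (simp add: XY sum_distrib_right mult.assoc)
  also have "\<dots> = (\<Sum>l\<in>I. \<Sum>k\<in>K. X i l * (Y l k * Z k j))"
    by (rule sum.swap)
  also have "\<dots> = (\<Sum>l\<in>I. X i l * bmul Y Z l j)"
    by (simp add: YZ sum_distrib_left)
  finally show "bmul (bmul X Y) Z i j = bmul X (bmul Y Z) i j"
    by (simp add: bmul_def I_def)
qed

lemma bmul_id_left: "bmul id_bimatrix X = X"
proof (intro ext)
  fix i j
  have "bmul id_bimatrix X i j = (\<Sum>k\<in>{i}. id_bimatrix i k * X k j)"
    by (rule bmul_eq_sum) (auto simp: id_bimatrix_def split: if_splits)
  then show "bmul id_bimatrix X i j = X i j" by (simp add: id_bimatrix_def)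
qed

lemma bmul_unique_term:
  assumes "row_finite X" "\<And>k. k \<noteq> l \<Longrightarrow> X i k = 0 \<or> Y k j = 0"
  shows "bmul X Y i j = X i l * Y l j"
proof -
  have "bmul X Y i j = (\<Sum>k\<in>insert l {k. X i k \<noteq> 0}. X i k * Y k j)"
    by (rule bmul_eq_sum) (use assms(1) in \<open>auto simp: row_finite_def\<close>)
  also have "\<dots> = (\<Sum>k\<in>{l}. X i k * Y k j)"
    by (rule sum.mono_neutral_right) (use assms in \<open>auto simp: row_finite_def\<close>)
  finally show ?thesis by simp
qed

lemma bmul_id_right:
  assumes "row_finite X"
  shows "bmul X id_bimatrix = X"
proof (intro ext)
  fix i j
  have "bmul X id_bimatrix i j = X i j * id_bimatrix j j"
    by (rule bmul_unique_term[OF assms]) (simp add: id_bimatrix_def)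
  then show "bmul X id_bimatrix i j = X i j" by (simp add: id_bimatrix_def)
qed

lemma bmul_single_entry:
  assumes "\<And>k. k \<noteq> l \<Longrightarrow> X i k = 0"
  shows "bmul X Y i j = X i l * Y l j"
  by (subst bmul_eq_sum[of "{l}"]) (use assms in auto)

lemma bmul_two_entries:
  assumes "\<And>k. k \<noteq> l \<Longrightarrow> k \<noteq> l' \<Longrightarrow> X i k = 0" "l \<noteq> l'"
  shows "bmul X Y i j = X i l * Y l j + X i l' * Y l' j"
  by (subst bmul_eq_sum[of "{l, l'}"]) (use assms in auto)

lemma reverse_bmul:
  "reverse_bimatrix (bmul X Y) = bmul (reverse_bimatrix X) (reverse_bimatrix Y)"
  unfolding bmul_def reverse_bimatrix_def
  by (intro ext sum.reindex_bij_witness[of _ uminus uminus]) auto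

lemma reverse_bimatrix_reverse [simp]: "reverse_bimatrix (reverse_bimatrix X) = X"
  by (simp add: reverse_bimatrix_def)

lemma reverse_id [simp]: "reverse_bimatrix id_bimatrix = id_bimatrix"
  by (auto simp: reverse_bimatrix_def id_bimatrix_def intro!: ext)

lemma loop_matrix_periodic:
  "loop_matrix n X \<Longrightarrow> X (i + int n) (j + int n) = X i j"
  by (simp add: loop_matrix_def)

lemma loop_matrix_row_finite:
  assumes "loop_matrix n X"
  shows "row_finite X"
proof -
  obtain N where N: "X i j \<noteq> 0 \<Longrightarrow> \<bar>j - i\<bar> \<le> N" for i j
    using assms by (auto simp: loop_matrix_def)
  have "finite {k. X i k \<noteq> 0}" for i
  proof (rule finite_subset)
    show "{k. X i k \<noteq> 0} \<subseteq> {i - N..i + N}"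
    proof
      fix k assume "k \<in> {k. X i k \<noteq> 0}"
      then show "k \<in> {i - N..i + N}" using N[of i k] by auto
    qed
  qed simp
  then show ?thesis by (simp add: row_finite_def)
qed

lemma loop_matrix_id: "loop_matrix n id_bimatrix"
  by (auto simp: loop_matrix_def id_bimatrix_def intro!: exI[of _ 0] split: if_splits)

lemma loop_matrix_bmul:
  assumes X: "loop_matrix n X" and Y: "loop_matrix n Y"
  shows "loop_matrix n (bmul X Y)"
proof -
  obtain N where N: "X i j \<noteq> 0 \<Longrightarrow> \<bar>j - i\<bar> \<le> N" for i j
    using X by (auto simp: loop_matrix_def)
  obtain M where M: "Y i j \<noteq> 0 \<Longrightarrow> \<bar>j - i\<bar> \<le> M" for i j
    using Y by (auto simp: loop_matrix_def)
  have "bmul X Y (i + int n) (j + int n) = bmul X Y i j" for i j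
    unfolding bmul_def
    by (rule sum.reindex_bij_witness[of _ "\<lambda>k. k + int n" "\<lambda>k. k - int n"])
      (use loop_matrix_periodic[OF X, of i] loop_matrix_periodic[OF X, of i "_ - int n"]
        loop_matrix_periodic[OF Y, of "_ - int n"] in auto)
  moreover have "\<bar>j - i\<bar> \<le> N + M" if nz: "bmul X Y i j \<noteq> 0" for i j
  proof -
    obtain k where "X i k \<noteq> 0" "Y k j \<noteq> 0" using nz by (rule bmul_nonzero)
    then have "\<bar>k - i\<bar> \<le> N" "\<bar>j - k\<bar> \<le> M" using N M by blast+
    then show ?thesis by linarith
  qed
  ultimately show ?thesis unfolding loop_matrix_def by blast
qed

lemma loop_matrix_reverse:
  assumes "loop_matrix n X"
  shows "loop_matrix n (reverse_bimatrix X)"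
proof -
  obtain N where N: "X i j \<noteq> 0 \<Longrightarrow> \<bar>j - i\<bar> \<le> N" for i j
    using assms by (auto simp: loop_matrix_def)
  have "\<bar>j - i\<bar> \<le> N" if "X (- i) (- j) \<noteq> 0" for i j
    using N[OF that] by linarith
  moreover have "X (- (i + int n)) (- (j + int n)) = X (- i) (- j)" for i j
    using loop_matrix_periodic[OF assms, of "- i - int n" "- j - int n"] by simp
  ultimately show ?thesis
    unfolding loop_matrix_def reverse_bimatrix_def by blast
qed

lemma loop_group_matrix: "X \<in> loop_group n \<Longrightarrow> loop_matrix n X"
  by (simp add: loop_group_def)

lemma loop_group_row_finite: "X \<in> loop_group n \<Longrightarrow> row_finite X"
  using loop_group_matrix loop_matrix_row_finite by blast

lemma loop_group_id: "id_bimatrix \<in> loop_group n"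
  using loop_matrix_id bmul_id_left by (auto simp: loop_group_def)

lemma loop_group_reverse:
  assumes "X \<in> loop_group n"
  shows "reverse_bimatrix X \<in> loop_group n"
proof -
  obtain Y where Y: "loop_matrix n Y" "bmul X Y = id_bimatrix" "bmul Y X = id_bimatrix"
    using assms by (auto simp: loop_group_def)
  then show ?thesis
    using assms unfolding loop_group_def
    by (auto intro!: loop_matrix_reverse exI[of _ "reverse_bimatrix Y"] simp flip: reverse_bmul)
qed

lemma loop_group_bmul:
  assumes "X \<in> loop_group n" "Y \<in> loop_group n"
  shows "bmul X Y \<in> loop_group n"
proof -
  obtain X' where X: "loop_matrix n X" "loop_matrix n X'" "bmul X X' = id_bimatrix" "bmul X' X = id_bimatrix"
    using assms(1) by (auto simp: loop_group_def)
  obtain Y' where Y: "loop_matrix n Y" "loop_matrix n Y'" "bmul Y Y' = id_bimatrix" "bmul Y' Y = id_bimatrix"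
    using assms(2) by (auto simp: loop_group_def)
  have inv: "bmul (bmul X Y) (bmul Y' X') = id_bimatrix"
    if "loop_matrix n X" "loop_matrix n Y" "loop_matrix n X'" "loop_matrix n Y'"
      "bmul X X' = id_bimatrix" "bmul Y Y' = id_bimatrix" for X Y X' Y'
  proof -
    have "bmul (bmul X Y) (bmul Y' X') = bmul X (bmul (bmul Y Y') X')"
      using that(1-4)[THEN loop_matrix_row_finite] by (simp add: bmul_assoc)
    then show ?thesis using that by (simp add: bmul_id_left)
  qed
  show ?thesis
    unfolding loop_group_def
    using X Y inv[of X Y X' Y'] inv[of Y' X' Y X]
    by (auto intro!: loop_matrix_bmul exI[of _ "bmul Y' X'"])
qed

lemma loop_group_row_nonzero:
  assumes "X \<in> loop_group n"
  obtains j where "X i j \<noteq> 0"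
proof -
  obtain Y where "bmul X Y = id_bimatrix" using assms by (auto simp: loop_group_def)
  then have "bmul X Y i i \<noteq> 0" by (simp add: id_bimatrix_def)
  then show ?thesis using that by (elim bmul_nonzero)
qed

section \<open>Unfolding as a group isomorphism\<close>

lemma lookup_times_int:
  fixes p q :: laurent
  shows "Poly_Mapping.lookup (p * q) k =
    (\<Sum>l\<in>Poly_Mapping.keys p. Poly_Mapping.lookup p l * Poly_Mapping.lookup q (k - l))"
proof -
  have "Sum_any (\<lambda>q'. Poly_Mapping.lookup q q' when k = l + q') = Poly_Mapping.lookup q (k - l)" for l
  proof -
    have "(\<lambda>q'. Poly_Mapping.lookup q q' when k = l + q') = (\<lambda>q'. Poly_Mapping.lookup q q' when q' = k - l)"
      by (intro ext) (auto simp: when_def)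
    then show ?thesis by (simp only: Sum_any_when_equal)
  qed
  then have "Poly_Mapping.lookup (p * q) k = Sum_any (\<lambda>l. Poly_Mapping.lookup p l * Poly_Mapping.lookup q (k - l))"
    by (simp add: lookup_mult)
  also have "\<dots> = (\<Sum>l\<in>Poly_Mapping.keys p. Poly_Mapping.lookup p l * Poly_Mapping.lookup q (k - l))"
    by (rule Sum_any.expand_superset) (auto simp: in_keys_iff)
  finally show ?thesis .
qed

text \<open>
  The highest and the lowest terms of \<open>p * q\<close> are the products of the respective terms of the factors.
  For \<open>p * q = 1\<close> both have degree 0, which leaves no room between the lowest and the
  highest degree of \<open>p\<close>.
\<close>

lemma laurent_unit_monomial:
  fixes p q :: laurent
  assumes "p * q = 1"
  shows "\<exists>k c. c \<noteq> 0 \<and> p = Poly_Mapping.single k c"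
proof -
  let ?l = Poly_Mapping.lookup and ?K = Poly_Mapping.keys
  have ne: "?K p \<noteq> {}" "?K q \<noteq> {}" using assms by auto
  have fin: "finite (?K p)" "finite (?K q)" by auto
  have "?l (p * q) (Max (?K p) + Max (?K q)) = (\<Sum>l\<in>{Max (?K p)}. ?l p l * ?l q (Max (?K p) + Max (?K q) - l))"
    unfolding lookup_times_int
  proof (rule sum.mono_neutral_right)
    show "\<forall>l\<in>?K p - {Max (?K p)}. ?l p l * ?l q (Max (?K p) + Max (?K q) - l) = 0"
    proof
      fix l assume l: "l \<in> ?K p - {Max (?K p)}"
      then have "l < Max (?K p)" using Max_ge[OF fin(1)] by (auto simp: less_le)
      then have "Max (?K p) + Max (?K q) - l \<notin> ?K q"
        using Max_ge[OF fin(2), of "Max (?K p) + Max (?K q) - l"] by linarith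
      then show "?l p l * ?l q (Max (?K p) + Max (?K q) - l) = 0" by (simp add: in_keys_iff)
    qed
  qed (use ne in auto)
  moreover have "?l p (Max (?K p)) \<noteq> 0" "?l q (Max (?K q)) \<noteq> 0"
    using ne by (auto simp: in_keys_iff[symmetric])
  ultimately have max: "Max (?K p) + Max (?K q) = 0"
    using assms by (auto simp: lookup_one when_def split: if_splits)
  have "?l (p * q) (Min (?K p) + Min (?K q)) = (\<Sum>l\<in>{Min (?K p)}. ?l p l * ?l q (Min (?K p) + Min (?K q) - l))"
    unfolding lookup_times_int
  proof (rule sum.mono_neutral_right)
    show "\<forall>l\<in>?K p - {Min (?K p)}. ?l p l * ?l q (Min (?K p) + Min (?K q) - l) = 0"
    proof
      fix l assume l: "l \<in> ?K p - {Min (?K p)}"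
      then have "l > Min (?K p)" using Min_le[OF fin(1)] by (auto simp: less_le)
      then have "Min (?K p) + Min (?K q) - l \<notin> ?K q"
        using Min_le[OF fin(2), of "Min (?K p) + Min (?K q) - l"] by linarith
      then show "?l p l * ?l q (Min (?K p) + Min (?K q) - l) = 0" by (simp add: in_keys_iff)
    qed
  qed (use ne in auto)
  moreover have "?l p (Min (?K p)) \<noteq> 0" "?l q (Min (?K q)) \<noteq> 0"
    using ne by (auto simp: in_keys_iff[symmetric])
  ultimately have min: "Min (?K p) + Min (?K q) = 0"
    using assms by (auto simp: lookup_one when_def split: if_splits)
  have "Min (?K p) \<le> Max (?K p)" "Min (?K q) \<le> Max (?K q)" using ne by auto
  then have eq: "Min (?K p) = Max (?K p)" using max min by linarith
  have K: "k = Max (?K p)" if "k \<in> ?K p" for k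
    using Min_le[OF fin(1) that] Max_ge[OF fin(1) that] eq by linarith
  have "p = Poly_Mapping.single (Max (?K p)) (?l p (Max (?K p)))"
    by (rule poly_mapping_eqI) (use K in \<open>auto simp: lookup_single when_def in_keys_iff\<close>)
  then show ?thesis using \<open>?l p (Max (?K p)) \<noteq> 0\<close> by blast
qed

lemma loop_matrix_unfolding:
  assumes "n \<ge> 1"
  shows "loop_matrix n (unfolding_mat n A)"
proof -
  define S where "S = (\<Union>a<n. \<Union>b<n. Poly_Mapping.keys (A $$ (a, b)))"
  have fin: "finite S" by (auto simp: S_def)
  define M where "M = (\<Sum>k\<in>S. \<bar>k\<bar>)"
  have "\<bar>j - i\<bar> \<le> (M + 1) * int n" if nz: "unfolding_mat n A i j \<noteq> 0" for i j
  proof -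
    define d where "d = (j - 1) div int n - (i - 1) div int n"
    define e where "e = (j - 1) mod int n - (i - 1) mod int n"
    have "d \<in> Poly_Mapping.keys (A $$ (nat ((i - 1) mod int n), nat ((j - 1) mod int n)))"
      using nz by (simp add: unfolding_mat_def d_def in_keys_iff)
    then have "d \<in> S" using assms unfolding S_def
      by (intro UN_I) (auto simp: nat_less_iff)
    then have d: "\<bar>d\<bar> \<le> M" unfolding M_def by (rule member_le_sum) (use fin in auto)
    have "0 \<le> (j - 1) mod int n" "(j - 1) mod int n < int n" "0 \<le> (i - 1) mod int n" "(i - 1) mod int n < int n"
      using assms by simp_all
    then have e: "\<bar>e\<bar> \<le> int n" unfolding e_def by linarith
    have "k - 1 = (k - 1) div int n * int n + (k - 1) mod int n" for k
      by simp
    from this[of j] this[of i] have "j - i = d * int n + e"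
      unfolding d_def e_def left_diff_distrib by linarith
    then have "\<bar>j - i\<bar> \<le> \<bar>d\<bar> * int n + \<bar>e\<bar>" by (metis abs_mult abs_of_nat abs_triangle_ineq)
    also have "\<dots> \<le> M * int n + int n" using d e by (intro add_mono mult_right_mono) auto
    finally show ?thesis by (simp add: distrib_right)
  qed
  then show ?thesis
    using unfolding_mat_periodic[OF assms] unfolding loop_matrix_def by blast
qed

lemma unfolding_folding_loop:
  assumes "n \<ge> 1" "loop_matrix n X"
  shows "unfolding_mat n (folding_mat n X) = X"
  using assms loop_matrix_row_finite[OF assms(2)]
  by (intro unfolding_folding) (auto simp: loop_matrix_def row_finite_def)

lemma folding_mat_carrier [simp]: "folding_mat n X \<in> carrier_mat n n"
  by (simp add: folding_mat_def)

lemma unfolding_mat_inject: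
  assumes "A \<in> carrier_mat n n" "B \<in> carrier_mat n n" "unfolding_mat n A = unfolding_mat n B"
  shows "A = B"
  using arg_cong[OF assms(3), of "folding_mat n"]
  by (simp only: folding_unfolding[OF assms(1)] folding_unfolding[OF assms(2)])

lemma unfolding_one:
  assumes "n \<ge> 1"
  shows "unfolding_mat n (1\<^sub>m n) = id_bimatrix"
proof (intro ext)
  fix i j :: int
  have eq: "k = (k - 1) div int n * int n + (k - 1) mod int n + 1" for k
    by simp
  have bound: "nat ((k - 1) mod int n) < n" for k
    using assms by (simp add: nat_less_iff)
  have nonneg: "0 \<le> (k - 1) mod int n" for k
    using assms by simp
  show "unfolding_mat n (1\<^sub>m n) i j = id_bimatrix i j"
  proof (cases "(i - 1) mod int n = (j - 1) mod int n")
    case True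
    then have "i = j" if "(j - 1) div int n = (i - 1) div int n"
      using eq[of i] eq[of j] that by metis
    then show ?thesis
      using True bound by (auto simp: unfolding_mat_def id_bimatrix_def lookup_one when_def)
  next
    case False
    then have "nat ((i - 1) mod int n) \<noteq> nat ((j - 1) mod int n)"
      using nonneg by (simp add: eq_nat_nat_iff)
    moreover have "i \<noteq> j" using False by auto
    ultimately show ?thesis
      using bound by (simp add: unfolding_mat_def id_bimatrix_def)
  qed
qed

text \<open>
  A column index \<open>k\<close> of the unfolded matrix corresponds to a pair of a residue \<open>l\<close> and a degree \<open>u\<close> via
  \<open>k = l + 1 + (p + u) n\<close>, where \<open>p\<close> is the block that contains the row \<open>i\<close>. This turns the sum
  for the matrix product together with the sums for the products of Laurent polynomials into
  a single sum over \<open>k\<close>.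
\<close>

lemma unfolding_mult:
  assumes n: "n \<ge> 1" and A: "A \<in> carrier_mat n n" and B: "B \<in> carrier_mat n n"
  shows "unfolding_mat n (A * B) = bmul (unfolding_mat n A) (unfolding_mat n B)"
proof (intro ext)
  fix i j :: int
  let ?l = Poly_Mapping.lookup and ?K = Poly_Mapping.keys
  define p q where "p = (i - 1) div int n" and "q = (j - 1) div int n"
  define a b where "a = nat ((i - 1) mod int n)" and "b = nat ((j - 1) mod int n)"
  have ab: "a < n" "b < n" using n by (auto simp: a_def b_def nat_less_iff)
  define g where "g = (\<lambda>(l, u). int l + 1 + (p + u) * int n)"
  define h where "h = (\<lambda>k. (nat ((k - 1) mod int n), (k - 1) div int n - p))"
  have div: "(g (l, u) - 1) div int n = p + u" "nat ((g (l, u) - 1) mod int n) = l" if "l < n" for l u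
    using that by (simp_all add: g_def)
  have gh: "g (h k) = k" for k
  proof -
    have "k - 1 = (k - 1) div int n * int n + (k - 1) mod int n" by simp
    then show ?thesis using n by (simp add: g_def h_def)
  qed
  have hg: "h (g (l, u)) = (l, u)" if "l < n" for l u
    using div[OF that] by (simp add: h_def)
  have X: "unfolding_mat n A i (g (l, u)) = ?l (A $$ (a, l)) u" if "l < n" for l u
    unfolding unfolding_mat_def div[OF that] by (simp add: a_def p_def)
  have Y: "unfolding_mat n B (g (l, u)) j = ?l (B $$ (l, b)) (q - p - u)" if "l < n" for l u
    unfolding unfolding_mat_def div[OF that] by (simp add: b_def q_def diff_diff_eq)
  have "unfolding_mat n (A * B) i j = ?l ((A * B) $$ (a, b)) (q - p)"
    by (simp add: unfolding_mat_def a_def b_def p_def q_def)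
  also have "(A * B) $$ (a, b) = (\<Sum>l<n. A $$ (a, l) * B $$ (l, b))"
    using A B ab by (simp add: scalar_prod_def lessThan_atLeast0)
  also have "?l \<dots> (q - p) = (\<Sum>l<n. \<Sum>u\<in>?K (A $$ (a, l)). ?l (A $$ (a, l)) u * ?l (B $$ (l, b)) (q - p - u))"
    by (simp add: lookup_sum lookup_times_int)
  also have "\<dots> = (\<Sum>(l, u)\<in>(SIGMA l:{..<n}. ?K (A $$ (a, l))). ?l (A $$ (a, l)) u * ?l (B $$ (l, b)) (q - p - u))"
    by (rule sum.Sigma) auto
  also have "\<dots> = (\<Sum>k | unfolding_mat n A i k \<noteq> 0. unfolding_mat n A i k * unfolding_mat n B k j)"
  proof (rule sum.reindex_bij_witness[of _ h g])
    fix x assume x: "x \<in> (SIGMA l:{..<n}. ?K (A $$ (a, l)))"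
    then obtain l u where lu: "x = (l, u)" "l < n" "u \<in> ?K (A $$ (a, l))" by auto
    show "h (g x) = x" using hg lu by simp
    show "g x \<in> {k. unfolding_mat n A i k \<noteq> 0}" using X lu by (simp add: in_keys_iff)
    show "unfolding_mat n A i (g x) * unfolding_mat n B (g x) j =
      (case x of (l, u) \<Rightarrow> ?l (A $$ (a, l)) u * ?l (B $$ (l, b)) (q - p - u))"
      using X Y lu by simp
  next
    fix k assume k: "k \<in> {k. unfolding_mat n A i k \<noteq> 0}"
    show "g (h k) = k" by (rule gh)
    obtain l u where lu: "h k = (l, u)" by fastforce
    then have l: "l < n" using n by (auto simp: h_def nat_less_iff)
    have "g (l, u) = k" using gh[of k] lu by simp
    then show "h k \<in> (SIGMA l:{..<n}. ?K (A $$ (a, l)))"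
      using k X[OF l, of u] l by (simp add: lu in_keys_iff)
  qed
  finally show "unfolding_mat n (A * B) i j = bmul (unfolding_mat n A) (unfolding_mat n B) i j"
    by (simp add: bmul_def)
qed

text \<open>
  Folding the inverse shows that the determinant is a unit, hence a monomial.
\<close>

lemma folding_mat_in_GL:
  assumes n: "n \<ge> 1" and X: "X \<in> loop_group n"
  shows "folding_mat n X \<in> GL_laurent n"
proof -
  obtain Y where Y: "loop_matrix n Y" "bmul X Y = id_bimatrix"
    using X by (auto simp: loop_group_def)
  let ?A = "folding_mat n X" and ?B = "folding_mat n Y"
  have "unfolding_mat n (?A * ?B) = unfolding_mat n (1\<^sub>m n)"
    using Y loop_group_matrix[OF X] n
    by (simp add: unfolding_mult unfolding_folding_loop unfolding_one)
  then have "?A * ?B = 1\<^sub>m n"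
    by (intro unfolding_mat_inject[of _ n] mult_carrier_mat[of _ n n]) auto
  then have "det ?A * det ?B = 1"
    using det_mult[of ?A n ?B] by simp
  then show ?thesis
    using laurent_unit_monomial by (auto simp: GL_laurent_def)
qed

text \<open>
  The inverse is the adjugate divided by the monomial determinant.
\<close>

lemma unfolding_GL:
  assumes n: "n \<ge> 1" and A: "A \<in> GL_laurent n"
  shows "unfolding_mat n A \<in> loop_group n"
proof -
  obtain k c where c: "c \<noteq> 0" "det A = Poly_Mapping.single k c" and Ac: "A \<in> carrier_mat n n"
    using A by (auto simp: GL_laurent_def)
  define B where "B = Poly_Mapping.single (- k) (1 / c) \<cdot>\<^sub>m adj_mat A"
  have adj: "adj_mat A \<in> carrier_mat n n" using adj_mat(1)[OF Ac] .
  have one: "Poly_Mapping.single (- k) (1 / c) * Poly_Mapping.single k c = (1::laurent)"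
    using c by (simp add: mult_single)
  have B: "B \<in> carrier_mat n n" using adj by (simp add: B_def)
  have smult: "Poly_Mapping.single (- k) (1 / c) \<cdot>\<^sub>m (Poly_Mapping.single k c \<cdot>\<^sub>m 1\<^sub>m n) = 1\<^sub>m n"
    using one by (intro eq_matI) (auto simp flip: mult.assoc)
  have "A * B = 1\<^sub>m n"
    unfolding B_def mult_smult_distrib[OF Ac adj] adj_mat(2)[OF Ac] c(2) by (rule smult)
  moreover have "B * A = 1\<^sub>m n"
    unfolding B_def mult_smult_assoc_mat[OF adj Ac] adj_mat(3)[OF Ac] c(2) by (rule smult)
  ultimately have "bmul (unfolding_mat n A) (unfolding_mat n B) = id_bimatrix"
    "bmul (unfolding_mat n B) (unfolding_mat n A) = id_bimatrix"
    unfolding unfolding_mult[OF n Ac B, symmetric] unfolding_mult[OF n B Ac, symmetric]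
    using unfolding_one[OF n] by simp_all
  then show ?thesis
    unfolding loop_group_def mem_Collect_eq
    by (intro conjI exI[of _ "unfolding_mat n B"] loop_matrix_unfolding[OF n])
qed

section \<open>Generators and their action on totally nonnegative matrices\<close>

definition chevalley_f_bimatrix :: "nat \<Rightarrow> int \<Rightarrow> real \<Rightarrow> bimatrix" where
  "chevalley_f_bimatrix n k a i j = chevalley_e_bimatrix n k a j i"

definition shift_power :: "int \<Rightarrow> bimatrix" where
  "shift_power s i j = (if j = i + s then 1 else 0)"

definition diag_bimatrix :: "(int \<Rightarrow> real) \<Rightarrow> bimatrix" where
  "diag_bimatrix d i j = (if i = j then d i else 0)"

lemma bmul_e: "bmul (chevalley_e_bimatrix n k a) X i j = X i j + (if [i = k] (mod int n) then a else 0) * X (i + 1) j"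
  by (subst bmul_two_entries[where l = i and l' = "i + 1"]) (auto simp: chevalley_e_bimatrix_def)

lemma bmul_shift: "bmul (shift_power s) X i j = X (i + s) j"
  by (subst bmul_single_entry[where l = "i + s"]) (auto simp: shift_power_def)

lemma bmul_diag: "bmul (diag_bimatrix d) X i j = d i * X i j"
  by (subst bmul_single_entry[where l = i]) (auto simp: diag_bimatrix_def)

text \<open>
  Since \<open>f_k\<close> adds a multiple of row \<open>k\<close> to row \<open>k + 1\<close>, its reversal adds a multiple of row \<open>- k\<close> to row
  \<open>- k - 1\<close>.
\<close>

lemma reverse_f: "reverse_bimatrix (chevalley_f_bimatrix n k a) = chevalley_e_bimatrix n (- k - 1) a"
proof -
  have "[- j = k] (mod int n) \<longleftrightarrow> [i = - k - 1] (mod int n)" if "j = i + 1" for i j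
  proof -
    have "[- j = k] (mod int n) \<longleftrightarrow> [- (- j) = - k] (mod int n)"
      by (rule cong_minus_minus_iff[symmetric])
    also have "\<dots> \<longleftrightarrow> [i + 1 = (- k - 1) + 1] (mod int n)" using that by (simp add: add.commute)
    also have "\<dots> \<longleftrightarrow> [i = - k - 1] (mod int n)" by (rule cong_add_rcancel)
    finally show ?thesis .
  qed
  then have "chevalley_f_bimatrix n k a (- i) (- j) = chevalley_e_bimatrix n (- k - 1) a i j" for i j
    by (cases "j = i + 1") (auto simp: chevalley_f_bimatrix_def chevalley_e_bimatrix_def)
  then show ?thesis by (simp add: reverse_bimatrix_def)
qed

lemma reverse_e: "reverse_bimatrix (chevalley_e_bimatrix n k a) = chevalley_f_bimatrix n (- k - 1) a"
  using reverse_bimatrix_reverse[of "chevalley_f_bimatrix n (- k - 1) a"] by (simp add: reverse_f)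

lemma bmul_f: "bmul (chevalley_f_bimatrix n k a) X i j = X i j + (if [i - 1 = k] (mod int n) then a else 0) * X (i - 1) j"
  by (subst bmul_two_entries[where l = i and l' = "i - 1"]) (auto simp: chevalley_f_bimatrix_def chevalley_e_bimatrix_def)

text \<open>
  For \<open>n \<ge> 2\<close>, the rows changed by a Chevalley generator and the rows it adds to them are disjoint.
\<close>

lemma not_cong_succ:
  assumes "n \<ge> 2" "[i = k] (mod int n)"
  shows "\<not> [i + 1 = k] (mod int n)"
proof
  assume "[i + 1 = k] (mod int n)"
  then have "[i + 1 = i + 0] (mod int n)" using cong_trans[OF _ cong_sym[OF assms(2)]] by simp
  then have "[1 = 0] (mod int n)" by (simp only: cong_add_lcancel)
  then show False using assms(1) by (simp add: cong_def)
qed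

lemma e_inverse:
  assumes "n \<ge> 2"
  shows "bmul (chevalley_e_bimatrix n k a) (chevalley_e_bimatrix n k (- a)) = id_bimatrix"
  using not_cong_succ[OF assms, of _ k]
  by (intro ext, unfold bmul_e) (auto simp: chevalley_e_bimatrix_def id_bimatrix_def)

lemma e_in_loop_group:
  assumes "n \<ge> 2"
  shows "chevalley_e_bimatrix n k a \<in> loop_group n"
proof -
  have "loop_matrix n (chevalley_e_bimatrix n k a)" for a
    unfolding loop_matrix_def using chevalley_e_bimatrix_periodic[of n k a]
    by (intro conjI exI[of _ 1]) (auto simp: chevalley_e_bimatrix_def)
  then show ?thesis
    using e_inverse[OF assms, of k a] e_inverse[OF assms, of k "- a"]
    by (auto simp: loop_group_def intro!: exI[of _ "chevalley_e_bimatrix n k (- a)"])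
qed

lemma f_in_loop_group:
  assumes "n \<ge> 2"
  shows "chevalley_f_bimatrix n k a \<in> loop_group n"
  using loop_group_reverse[OF e_in_loop_group[OF assms, of "- k - 1" a]] by (simp add: reverse_e)

lemma f_inverse:
  assumes "n \<ge> 2"
  shows "bmul (chevalley_f_bimatrix n k a) (chevalley_f_bimatrix n k (- a)) = id_bimatrix"
  using arg_cong[OF e_inverse[OF assms, of "- k - 1" a], of reverse_bimatrix]
  by (simp add: reverse_bmul reverse_e)

lemma shift_in_loop_group: "shift_power s \<in> loop_group n"
proof -
  have "loop_matrix n (shift_power s)" for s
    unfolding loop_matrix_def by (intro conjI exI[of _ "\<bar>s\<bar>"]) (auto simp: shift_power_def)
  moreover have "bmul (shift_power s) (shift_power (- s)) = id_bimatrix" for s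
    by (intro ext) (auto simp: bmul_shift id_bimatrix_def shift_power_def)
  from this[of s] this[of "- s"]
  have "bmul (shift_power s) (shift_power (- s)) = id_bimatrix" "bmul (shift_power (- s)) (shift_power s) = id_bimatrix"
    by simp_all
  ultimately show ?thesis unfolding loop_group_def by blast
qed

lemma diag_in_loop_group:
  assumes "\<And>i. d (i + int n) = d i" "\<And>i. d i \<noteq> 0"
  shows "diag_bimatrix d \<in> loop_group n"
proof -
  have "loop_matrix n (diag_bimatrix d)" if "\<And>i. d (i + int n) = d i" for d
    unfolding loop_matrix_def using that by (intro conjI exI[of _ 0]) (auto simp: diag_bimatrix_def)
  from this[of d] this[of "\<lambda>i. 1 / d i"]
  have "loop_matrix n (diag_bimatrix d)" "loop_matrix n (diag_bimatrix (\<lambda>i. 1 / d i))" using assms(1) by auto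
  moreover have "bmul (diag_bimatrix d) (diag_bimatrix (\<lambda>i. 1 / d i)) = id_bimatrix"
    "bmul (diag_bimatrix (\<lambda>i. 1 / d i)) (diag_bimatrix d) = id_bimatrix"
    using assms(2) by (auto intro!: ext simp: bmul_diag id_bimatrix_def diag_bimatrix_def)
  ultimately show ?thesis unfolding loop_group_def by blast
qed

lemma totally_nonnegative_e:
  assumes "totally_nonnegative X" "a \<ge> 0"
  shows "totally_nonnegative (bmul (chevalley_e_bimatrix n k a) X)"
proof -
  have "bmul (chevalley_e_bimatrix n k a) X = (\<lambda>i j. X i j + (if [i = k] (mod int n) then a else 0) * X (i + 1) j)"
    by (intro ext bmul_e)
  then show ?thesis
    using totally_nonnegative_bidiagonal[OF assms(1)] assms(2) by simp
qed

lemma totally_nonnegative_f: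
  assumes "totally_nonnegative X" "a \<ge> 0"
  shows "totally_nonnegative (bmul (chevalley_f_bimatrix n k a) X)"
proof -
  have "bmul (chevalley_f_bimatrix n k a) X = reverse_bimatrix (bmul (chevalley_e_bimatrix n (- k - 1) a) (reverse_bimatrix X))"
    by (simp add: reverse_bmul reverse_e)
  then show ?thesis
    using assms by (simp add: totally_nonnegative_reverse totally_nonnegative_e)
qed

lemma totally_nonnegative_shift:
  assumes "totally_nonnegative X"
  shows "totally_nonnegative (bmul (shift_power s) X)"
  unfolding totally_nonnegative_def
proof (intro allI impI)
  fix m :: nat and r c :: "nat \<Rightarrow> int"
  assume r: "strict_mono_on {..<m} r" and c: "strict_mono_on {..<m} c"
  have "strict_mono_on {..<m} (\<lambda>a. r a + s)" using r by (auto simp: strict_mono_on_def)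
  from totally_nonnegativeD[OF assms this c]
  show "0 \<le> minor (bmul (shift_power s) X) m r c" by (simp add: minor_def bmul_shift)
qed

lemma totally_nonnegative_diag:
  assumes X: "totally_nonnegative X" and d: "\<And>i. d i \<ge> 0"
  shows "totally_nonnegative (bmul (diag_bimatrix d) X)"
  unfolding totally_nonnegative_def
proof (intro allI impI)
  fix m :: nat and r c :: "nat \<Rightarrow> int"
  assume r: "strict_mono_on {..<m} r" and c: "strict_mono_on {..<m} c"
  have "minor (bmul (diag_bimatrix d) X) m r c =
    (\<Sum>p | p permutes {0..<m}. signof p * (\<Prod>a = 0..<m. d (r a) * X (r a) (c (p a))))"
    unfolding minor_def
    by (subst det_def'[of _ m]) (auto intro!: sum.cong prod.cong simp: bmul_diag)
  also have "\<dots> = (\<Prod>a = 0..<m. d (r a)) * 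
    (\<Sum>p | p permutes {0..<m}. signof p * (\<Prod>a = 0..<m. X (r a) (c (p a))))"
    by (simp add: prod.distrib sum_distrib_left mult_ac)
  also have "(\<Sum>p | p permutes {0..<m}. signof p * (\<Prod>a = 0..<m. X (r a) (c (p a)))) = minor X m r c"
    unfolding minor_def
    by (subst det_def'[of _ m]) (auto intro!: sum.cong prod.cong)
  finally show "0 \<le> minor (bmul (diag_bimatrix d) X) m r c"
    using totally_nonnegativeD[OF X r c] d by (simp add: prod_nonneg)
qed

lemma totally_nonnegative_id: "totally_nonnegative id_bimatrix"
proof -
  have "minor id_bimatrix m r c \<ge> 0" if "strict_mono_on {..<m} r" "strict_mono_on {..<m} c" for m r c
    using that
  proof (induction m arbitrary: r c)
    case 0
    then show ?case by (simp add: minor_def)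
  next
    case (Suc m)
    have r: "r 0 \<le> r a" if "a < Suc m" for a
      using strict_mono_onD[OF Suc.prems(1), of 0 a] that by (cases "a = 0") auto
    have c: "c 0 \<le> c a" if "a < Suc m" for a
      using strict_mono_onD[OF Suc.prems(2), of 0 a] that by (cases "a = 0") auto
    consider "r 0 < c 0" | "c 0 < r 0" | "r 0 = c 0" by linarith
    then show ?case
    proof cases
      case 1
      have "id_bimatrix (r 0) (c b) = 0" if "b < Suc m" for b
        using c[OF that] 1 by (simp add: id_bimatrix_def)
      then have "minor id_bimatrix (Suc m) r c = 0"
        by (subst minor_expand_row[of 0]) (auto intro!: sum.neutral simp del: sum.lessThan_Suc)
      then show ?thesis by simp
    next
      case 2
      have "id_bimatrix (r a) (c 0) = 0" if "a < Suc m" for a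
        using r[OF that] 2 by (simp add: id_bimatrix_def)
      then have "minor id_bimatrix (Suc m) r c = 0"
        by (subst minor_expand_column[of 0]) (auto intro!: sum.neutral simp del: sum.lessThan_Suc)
      then show ?thesis by simp
    next
      case 3
      have z: "id_bimatrix (r 0) (c b) = 0" if "b \<in> {..<Suc m} - {0}" for b
        using strict_mono_onD[OF Suc.prems(2), of 0 b] that 3 by (auto simp: id_bimatrix_def)
      have "minor id_bimatrix (Suc m) r c =
        (\<Sum>b<Suc m. id_bimatrix (r 0) (c b) * ((-1) ^ (0 + b) * minor id_bimatrix m (r \<circ> insert_index 0) (c \<circ> insert_index b)))"
        by (rule minor_expand_row) simp
      also have "\<dots> = (\<Sum>b\<in>{0}. id_bimatrix (r 0) (c b) * ((-1) ^ (0 + b) * minor id_bimatrix m (r \<circ> insert_index 0) (c \<circ> insert_index b)))"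
        by (rule sum.mono_neutral_right) (use z in auto)
      also have "\<dots> = minor id_bimatrix m (r \<circ> insert_index 0) (c \<circ> insert_index 0)"
        using 3 by (simp add: id_bimatrix_def)
      also have "\<dots> \<ge> 0"
        by (intro Suc.IH strict_mono_on_insert_index Suc.prems)
      finally show ?thesis .
    qed
  qed
  then show ?thesis by (simp add: totally_nonnegative_def)
qed

definition generators :: "nat \<Rightarrow> laurent mat set" where
  "generators n = {shift_mat n} \<union> shift_inverses n \<union> positive_torus n \<union> positive_chevalley_generators n"

lemma unfolding_shift: "n \<ge> 1 \<Longrightarrow> unfolding_mat n (shift_mat n) = shift_power 1"
  by (intro ext) (simp add: unfolding_shift_mat shift_power_def shift_bimatrix_def)

lemma unfolding_shift_inverse:
  assumes n: "n \<ge> 1" and B: "B \<in> shift_inverses n"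
  shows "unfolding_mat n B = shift_power (- 1)"
proof (intro ext)
  fix i j
  have S: "shift_mat n \<in> carrier_mat n n" by (simp add: shift_mat_def)
  have Bc: "B \<in> carrier_mat n n" and "shift_mat n * B = 1\<^sub>m n"
    using B S by (auto simp: shift_inverses_def inverts_mat_def)
  then have "bmul (shift_power 1) (unfolding_mat n B) = id_bimatrix"
    using unfolding_mult[OF n S Bc] unfolding_one[OF n] unfolding_shift[OF n] by simp
  then have "bmul (shift_power 1) (unfolding_mat n B) (i - 1) j = id_bimatrix (i - 1) j" by simp
  then show "unfolding_mat n B i j = shift_power (- 1) i j"
    by (auto simp: bmul_shift id_bimatrix_def shift_power_def)
qed

lemma unfolding_torus:
  assumes n: "n \<ge> 1"
  shows "unfolding_mat n (mat_diag n (\<lambda>i. Poly_Mapping.single 0 (d i))) =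
    diag_bimatrix (\<lambda>i. d (nat ((i - 1) mod int n)))"
proof (intro ext)
  fix i j :: int
  have eq: "k = (k - 1) div int n * int n + (k - 1) mod int n + 1" for k
    by simp
  have bound: "nat ((k - 1) mod int n) < n" for k
    using n by (simp add: nat_less_iff)
  have nonneg: "0 \<le> (k - 1) mod int n" for k
    using n by simp
  show "unfolding_mat n (mat_diag n (\<lambda>i. Poly_Mapping.single 0 (d i))) i j =
    diag_bimatrix (\<lambda>i. d (nat ((i - 1) mod int n))) i j"
  proof (cases "(i - 1) mod int n = (j - 1) mod int n")
    case True
    then have "i = j" if "(j - 1) div int n = (i - 1) div int n"
      using eq[of i] eq[of j] that by metis
    then show ?thesis
      using True bound
      by (auto simp: unfolding_mat_def diag_bimatrix_def mat_diag_def lookup_single when_def)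
  next
    case False
    then have "nat ((i - 1) mod int n) \<noteq> nat ((j - 1) mod int n)"
      using nonneg by (simp add: eq_nat_nat_iff)
    moreover have "i \<noteq> j" using False by auto
    ultimately show ?thesis
      using bound by (simp add: unfolding_mat_def diag_bimatrix_def mat_diag_def)
  qed
qed

lemma generator_unfolding_cases:
  assumes n: "n \<ge> 1" and A: "A \<in> generators n"
  obtains s where "unfolding_mat n A = shift_power s"
  | d where "unfolding_mat n A = diag_bimatrix d" "\<And>i. d (i + int n) = d i" "\<And>i. d i > 0"
  | k a where "n \<ge> 2" "a > 0" "unfolding_mat n A = chevalley_e_bimatrix n k a"
  | k a where "n \<ge> 2" "a > 0" "unfolding_mat n A = chevalley_f_bimatrix n k a"
proof -
  consider "A = shift_mat n" | "A \<in> shift_inverses n" | "A \<in> positive_torus n"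
    | "A \<in> positive_chevalley_generators n"
    using A by (auto simp: generators_def)
  then show ?thesis
  proof cases
    case 1
    then show ?thesis using that(1) unfolding_shift[OF n] by simp
  next
    case 2
    then show ?thesis using that(1) unfolding_shift_inverse[OF n] by simp
  next
    case 3
    then obtain d where d: "A = mat_diag n (\<lambda>i. Poly_Mapping.single 0 (d i))" "\<forall>i<n. d i > 0"
      by (auto simp: positive_torus_def)
    show ?thesis
    proof (rule that(2))
      show "unfolding_mat n A = diag_bimatrix (\<lambda>i. d (nat ((i - 1) mod int n)))"
        using unfolding_torus[OF n] d by simp
      show "d (nat ((i + int n - 1) mod int n)) = d (nat ((i - 1) mod int n))" for i
        using mod_add_self2[of "i - 1" "int n"] by (simp add: algebra_simps)
      show "d (nat ((i - 1) mod int n)) > 0" for i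
        using d(2) n by (simp add: nat_less_iff)
    qed
  next
    case 4
    then have "n \<noteq> 1" by (auto simp: positive_chevalley_generators_def)
    then have n2: "n \<ge> 2" using n by simp
    from 4 \<open>n \<noteq> 1\<close> consider k a where "a > 0" "A = chevalley_e n k a"
      | k a where "a > 0" "A = chevalley_f n k a"
      by (auto simp: positive_chevalley_generators_def)
    then show ?thesis
    proof cases
      case 1
      then show ?thesis using that(3)[OF n2] unfolding_chevalley_e[OF n] by blast
    next
      case 2
      then show ?thesis using that(4)[OF n2] unfolding_chevalley_f[OF n] by (simp add: chevalley_f_bimatrix_def[abs_def])
    qed
  qed
qed

lemma generator_carrier: "A \<in> generators n \<Longrightarrow> A \<in> carrier_mat n n"
  by (auto simp: generators_def shift_mat_def shift_inverses_def positive_torus_def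
      positive_chevalley_generators_def chevalley_e_def chevalley_f_def split: if_splits)

lemma generated_carrier: "A \<in> generated_semigroup (generators n) \<Longrightarrow> A \<in> carrier_mat n n"
  by (induction rule: generated_semigroup.induct) (auto intro: generator_carrier mult_carrier_mat)

text \<open>
  Preservation of total nonnegativity under left multiplication is inherited by products by mere
  associativity, which spares the Cauchy-Binet formula.
\<close>

lemma generated_sound:
  assumes n: "n \<ge> 1" and "A \<in> generated_semigroup (generators n)"
  shows "unfolding_mat n A \<in> loop_group n \<and>
    (\<forall>X. totally_nonnegative X \<longrightarrow> totally_nonnegative (bmul (unfolding_mat n A) X))"
  using assms(2)
proof (induction rule: generated_semigroup.induct)
  case (generator A)
  from n generator show ?case
  proof (cases rule: generator_unfolding_cases)
    case (1 s)
    then show ?thesis using shift_in_loop_group totally_nonnegative_shift by simp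
  next
    case (2 d)
    then show ?thesis
      using diag_in_loop_group[of d n] totally_nonnegative_diag[of _ d] by (simp add: less_imp_le less_imp_neq[symmetric])
  next
    case (3 k a)
    then show ?thesis using e_in_loop_group totally_nonnegative_e by simp
  next
    case (4 k a)
    then show ?thesis using f_in_loop_group totally_nonnegative_f by simp
  qed
next
  case (mult A B)
  have "unfolding_mat n (A * B) = bmul (unfolding_mat n A) (unfolding_mat n B)"
    using mult.hyps by (intro unfolding_mult[OF n] generated_carrier)
  moreover have "bmul (bmul (unfolding_mat n A) (unfolding_mat n B)) X =
    bmul (unfolding_mat n A) (bmul (unfolding_mat n B) X)" for X
    using mult.IH by (intro bmul_assoc loop_group_row_finite[of _ n]) auto
  ultimately show ?case
    using mult.IH by (simp add: loop_group_bmul)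
qed

lemma generated_subset_nonneg:
  assumes n: "n \<ge> 1"
  shows "generated_semigroup (generators n) \<subseteq> GL_laurent_nonneg n"
proof
  fix A assume A: "A \<in> generated_semigroup (generators n)"
  note s = generated_sound[OF n A]
  have "totally_nonnegative (bmul (unfolding_mat n A) id_bimatrix)"
    using s totally_nonnegative_id by blast
  then have "totally_nonnegative (unfolding_mat n A)"
    unfolding bmul_id_right[OF loop_group_row_finite[OF conjunct1[OF s]]] .
  moreover have "A \<in> GL_laurent n"
    using folding_mat_in_GL[OF n conjunct1[OF s]] folding_unfolding[OF generated_carrier[OF A]] by simp
  ultimately show "A \<in> GL_laurent_nonneg n" by (simp add: GL_laurent_nonneg_def)
qed

section \<open>Elimination\<close>

text \<open>
  The column of the first nonzero entry of row \<open>i\<close>. The minimum exists for members of \<open>loop_group n\<close>, as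
  their rows are nonzero and finitely supported.
\<close>

definition lead :: "bimatrix \<Rightarrow> int \<Rightarrow> int" where
  "lead X i = Min {j. X i j \<noteq> 0}"

lemma lead_nonzero:
  assumes "X \<in> loop_group n"
  shows "X i (lead X i) \<noteq> 0"
proof -
  have "finite {j. X i j \<noteq> 0}"
    using loop_group_row_finite[OF assms] by (simp add: row_finite_def)
  moreover have "{j. X i j \<noteq> 0} \<noteq> {}"
    using loop_group_row_nonzero[OF assms, of i] by blast
  ultimately show ?thesis using Min_in unfolding lead_def by blast
qed

lemma lead_le:
  assumes "X \<in> loop_group n" "X i j \<noteq> 0"
  shows "lead X i \<le> j"
  using loop_group_row_finite[OF assms(1)] assms(2) by (simp add: lead_def row_finite_def)

lemma zero_before_lead:
  assumes "X \<in> loop_group n" "j < lead X i"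
  shows "X i j = 0"
  using lead_le[OF assms(1), of i j] assms(2) by force

lemma lead_eqI:
  assumes "X \<in> loop_group n" "X i j \<noteq> 0" "\<And>l. l < j \<Longrightarrow> X i l = 0"
  shows "lead X i = j"
  using lead_le[OF assms(1,2)] lead_nonzero[OF assms(1), of i] assms(3)[of "lead X i"] by force

lemma loop_group_periodic:
  assumes "X \<in> loop_group n"
  shows "X (i + m * int n) (j + m * int n) = X i j"
proof -
  have p: "X (i + int n) (j + int n) = X i j" for i j
    using loop_matrix_periodic[OF loop_group_matrix[OF assms]] .
  have nat: "X (i + int k * int n) (j + int k * int n) = X i j" for k i j
  proof (induction k)
    case (Suc k)
    then show ?case using p[of "i + int k * int n" "j + int k * int n"] by (simp add: algebra_simps)
  qed simp
  show ?thesis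
  proof (cases "m \<ge> 0")
    case True
    then show ?thesis using nat[of i "nat m" j] by simp
  next
    case False
    then show ?thesis using nat[of "i + m * int n" "nat (- m)" "j + m * int n"] by simp
  qed
qed

lemma lead_periodic:
  assumes "X \<in> loop_group n"
  shows "lead X (i + m * int n) = lead X i + m * int n"
proof (rule lead_eqI[OF assms])
  show "X (i + m * int n) (lead X i + m * int n) \<noteq> 0"
    using lead_nonzero[OF assms] loop_group_periodic[OF assms] by simp
  show "X (i + m * int n) l = 0" if "l < lead X i + m * int n" for l
    using loop_group_periodic[OF assms, of i m "l - m * int n"] that
      zero_before_lead[OF assms, of "l - m * int n" i] by simp
qed

lemma totally_nonnegative_2x2:
  assumes "totally_nonnegative X" "i < i'" "j < j'"
  shows "X i j' * X i' j \<le> X i j * X i' j'"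
proof -
  define r c where "r = (\<lambda>a::nat. if a = 0 then i else i')" and "c = (\<lambda>a::nat. if a = 0 then j else j')"
  have "0 \<le> minor X (Suc 1) r c"
    by (rule totally_nonnegativeD[OF assms(1)])
      (use assms in \<open>auto simp: strict_mono_on_def r_def c_def\<close>)
  also have "\<dots> = X i j * X i' j' - X i j' * X i' j"
    by (subst minor_expand_row[of 0]) (auto simp: minor_def det_single r_def c_def insert_index_def)
  finally show ?thesis by simp
qed

text \<open>
  If the leading column dropped from row \<open>i\<close> to row \<open>i + 1\<close>, these two rows and their leading columns would give a
  negative \<open>2 \<times> 2\<close> minor with a zero in its upper left corner.
\<close>

lemma lead_step_mono:
  assumes X: "X \<in> loop_group n" and tnn: "totally_nonnegative X"
  shows "lead X i \<le> lead X (i + 1)"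
proof (rule ccontr)
  assume "\<not> ?thesis"
  then have l: "lead X (i + 1) < lead X i" by simp
  have "X i (lead X i) * X (i + 1) (lead X (i + 1)) \<le> X i (lead X (i + 1)) * X (i + 1) (lead X i)"
    by (rule totally_nonnegative_2x2[OF tnn]) (use l in auto)
  also have "\<dots> = 0" using zero_before_lead[OF X l] by simp
  finally show False
    using lead_nonzero[OF X, of i] lead_nonzero[OF X, of "i + 1"]
      totally_nonnegative_entry[OF tnn, of i "lead X i"]
      totally_nonnegative_entry[OF tnn, of "i + 1" "lead X (i + 1)"]
    by (simp add: mult_le_0_iff)
qed

lemma mono_of_step:
  fixes f :: "int \<Rightarrow> int"
  assumes "\<And>i. f i \<le> f (i + 1)" "i \<le> j"
  shows "f i \<le> f j"
  using assms(2)
proof (induction j rule: int_ge_induct)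
  case (step j)
  then show ?case using assms(1)[of j] by linarith
qed simp

text \<open>
  The function \<open>lead X i - i\<close> is weakly increasing and periodic, hence constant.
\<close>

lemma lead_strict_shift:
  assumes n: "n \<ge> 1" and X: "X \<in> loop_group n" and strict: "\<And>i. lead X i < lead X (i + 1)"
  obtains s where "\<And>i. lead X i = i + s"
proof
  fix i
  have mono: "lead X i - i \<le> lead X j - j" if "i \<le> j" for i j
    by (rule mono_of_step[OF _ that]) (use strict in \<open>auto simp: zless_iff_Suc_zadd intro: order_trans\<close>)
  have per: "lead X (i + m * int n) - (i + m * int n) = lead X i - i" for i m
    by (simp add: lead_periodic[OF X])
  have "\<bar>i\<bar> * 1 \<le> \<bar>i\<bar> * int n" by (rule mult_left_mono) (use n in auto)
  then have "0 \<le> i + \<bar>i\<bar> * int n" "i - \<bar>i\<bar> * int n \<le> 0" by linarith+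
  from mono[OF this(1)] mono[OF this(2)] per[of i "\<bar>i\<bar>"] per[of i "- \<bar>i\<bar>"]
  show "lead X i = i + lead X 0" by simp
qed

text \<open>
  A run of equal leading columns cannot go on forever, since the leading column advances by \<open>n\<close> over
  one period.
\<close>

lemma lead_last_of_run:
  assumes n: "n \<ge> 1" and X: "X \<in> loop_group n" and tnn: "totally_nonnegative X"
    and tie: "lead X i0 = lead X (i0 + 1)"
  obtains i where "lead X i = lead X (i + 1)" "lead X (i + 1) < lead X (i + 2)"
proof (rule ccontr)
  note witness = that
  assume contra: "\<not> thesis"
  have next_tie: "lead X (i + 1) = lead X (i + 2)" if eq: "lead X i = lead X (i + 1)" for i
  proof -
    have "\<not> lead X (i + 1) < lead X (i + 2)" using witness[OF eq] contra by blast
    moreover have "lead X (i + 1) \<le> lead X (i + 2)"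
      using lead_step_mono[OF X tnn, of "i + 1"] by (simp add: add.assoc)
    ultimately show ?thesis by linarith
  qed
  have "lead X (i0 + int k) = lead X i0 \<and> lead X (i0 + int k) = lead X (i0 + int k + 1)" for k
  proof (induction k)
    case 0
    then show ?case using tie by simp
  next
    case (Suc k)
    then show ?case using next_tie[of "i0 + int k"] by (simp add: algebra_simps)
  qed
  from this[of n] show False using lead_periodic[OF X, of i0 1] n by simp
qed

text \<open>
  The elimination strips off generators \<open>f_k\<close> from the left only. Keeping track of this is necessary because the
  second round of the elimination acts on a reversed matrix, where each \<open>f_k\<close> stands for an \<open>e\<close> generator.
\<close>

inductive_set f_products :: "nat \<Rightarrow> bimatrix set" for n where
  id: "id_bimatrix \<in> f_products n"
| step: "n \<ge> 2 \<Longrightarrow> a > 0 \<Longrightarrow> G \<in> f_products n \<Longrightarrow> bmul (chevalley_f_bimatrix n k a) G \<in> f_products n"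

lemma f_products_in_loop_group: "G \<in> f_products n \<Longrightarrow> G \<in> loop_group n"
  by (induction rule: f_products.induct) (auto intro: loop_group_id loop_group_bmul f_in_loop_group)

text \<open>
  One elimination step. The row \<open>i + 1\<close> is the last one of a run of equal leading columns, so all later rows
  vanish in that column. Subtracting the multiple of row \<open>i\<close> that clears it, at every translate by a
  multiple of \<open>n\<close>, is left multiplication by \<open>f_i (- a)\<close>, and moves the leading column of these rows to the right.
\<close>

lemma whitney_elimination:
  assumes n: "n \<ge> 1" and X: "X \<in> loop_group n" and tnn: "totally_nonnegative X"
    and tie: "lead X i = lead X (i + 1)" and last: "lead X (i + 1) < lead X (i + 2)"
  obtains a Z where "n \<ge> 2" "a > 0" "Z \<in> loop_group n" "totally_nonnegative Z"
    "X = bmul (chevalley_f_bimatrix n i a) Z" 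
    "\<And>r l. Z r l = X r l + (if [r - 1 = i] (mod int n) then - a else 0) * X (r - 1) l"
    "\<And>r. lead X r \<le> lead Z r" "\<And>r. [r - 1 = i] (mod int n) \<Longrightarrow> lead X r < lead Z r"
proof -
  define j where "j = lead X (i + 1)"
  define a where "a = X (i + 1) j / X i j"
  have pos: "X i j > 0" "X (i + 1) j > 0"
    using lead_nonzero[OF X, of i] lead_nonzero[OF X, of "i + 1"] tie
      totally_nonnegative_entry[OF tnn, of i j] totally_nonnegative_entry[OF tnn, of "i + 1" j]
    by (auto simp: j_def less_le)
  have a: "a > 0" using pos by (simp add: a_def)
  have "n \<noteq> 1"
  proof
    assume "n = 1"
    then show False using lead_periodic[OF X, of i 1] tie by simp
  qed
  then have n2: "n \<ge> 2" using n by simp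
  define P where "P = {r. [r - 1 = i] (mod int n)}"
  have P: "\<exists>m. r = i + 1 + m * int n" if "r \<in> P" for r
  proof -
    have "[i = r - 1] (mod int n)" using that cong_sym by (auto simp: P_def)
    then obtain m where "r - 1 = i + int n * m" unfolding cong_iff_lin by blast
    then show ?thesis by (intro exI[of _ m]) (simp add: algebra_simps)
  qed
  have leadP: "lead X (r - 1) = lead X r" "lead X r < lead X (r + 1)"
    "X r (lead X r) / X (r - 1) (lead X r) = a" if rP: "r \<in> P" for r
  proof -
    obtain m where r: "r = i + 1 + m * int n" using P[OF rP] by blast
    have e: "lead X (r - 1) = lead X i + m * int n" "lead X r = j + m * int n"
      "lead X (r + 1) = lead X (i + 2) + m * int n"
      using lead_periodic[OF X, of i m] lead_periodic[OF X, of "i + 1" m] lead_periodic[OF X, of "i + 2" m]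
      by (simp_all add: r j_def algebra_simps)
    show "lead X (r - 1) = lead X r" "lead X r < lead X (r + 1)"
      using e tie last by (simp_all add: j_def)
    have "X r (lead X r) = X (i + 1) j" "X (r - 1) (lead X r) = X i j"
      unfolding e using loop_group_periodic[OF X, of "i + 1" m j] loop_group_periodic[OF X, of i m j]
      by (simp_all add: r algebra_simps)
    then show "X r (lead X r) / X (r - 1) (lead X r) = a" by (simp add: a_def)
  qed
  have lead_mono: "lead X r \<le> lead X k" if "r \<le> k" for r k
    by (rule mono_of_step[of "lead X", OF lead_step_mono[OF X tnn] that])
  define Z where "Z = bmul (chevalley_f_bimatrix n i (- a)) X"
  have Zrow: "Z r l = X r l + (if [r - 1 = i] (mod int n) then - a else 0) * X (r - 1) l" for r l
    unfolding Z_def by (rule bmul_f)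
  have Zgroup: "Z \<in> loop_group n"
    unfolding Z_def by (intro loop_group_bmul f_in_loop_group n2 X)
  have "totally_nonnegative (\<lambda>r l.
    if r \<in> P then X r l + (- X r (lead X r) / X (r - 1) (lead X r)) * X (r - 1) l else X r l)"
  proof (rule totally_nonnegative_whitney[OF tnn])
    show "r - 1 \<notin> P" if "r \<in> P" for r
      using not_cong_succ[OF n2, of "r - 1 - 1" i] that by (auto simp: P_def)
    show "X (r - 1) (lead X r) > 0" if "r \<in> P" for r
      using lead_nonzero[OF X, of "r - 1"] leadP(1)[OF that]
        totally_nonnegative_entry[OF tnn, of "r - 1" "lead X r"] by (simp add: less_le)
    show "X k l = 0" if "r \<in> P" "k \<ge> r - 1" "l < lead X r" for r k l
      using lead_mono[OF that(2)] leadP(1)[OF that(1)] that(3) by (intro zero_before_lead[OF X]) simp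
    show "X k (lead X r) = 0" if "r \<in> P" "k > r" for r k
      using lead_mono[of "r + 1" k] leadP(2)[OF that(1)] that(2) by (intro zero_before_lead[OF X]) simp
  qed
  also have "(\<lambda>r l. if r \<in> P then X r l + (- X r (lead X r) / X (r - 1) (lead X r)) * X (r - 1) l else X r l) = Z"
  proof (intro ext)
    fix r l
    show "(if r \<in> P then X r l + (- X r (lead X r) / X (r - 1) (lead X r)) * X (r - 1) l else X r l) = Z r l"
      using leadP(3)[of r] by (simp add: Zrow P_def)
  qed
  finally have Ztnn: "totally_nonnegative Z" .
  have XZ: "X = bmul (chevalley_f_bimatrix n i a) Z"
    unfolding Z_def
    by (subst bmul_assoc[symmetric])
      (use n2 in \<open>auto intro: loop_group_row_finite f_in_loop_group simp: f_inverse bmul_id_left\<close>)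
  have le: "lead X r \<le> lead Z r" for r
  proof (rule ccontr)
    assume "\<not> ?thesis"
    then have l: "lead Z r < lead X r" by simp
    have "X (r - 1) (lead Z r) = 0" if "r \<in> P"
      using l leadP(1)[OF that] by (intro zero_before_lead[OF X]) simp
    then have "Z r (lead Z r) = 0"
      using zero_before_lead[OF X l] by (auto simp: Zrow P_def)
    then show False using lead_nonzero[OF Zgroup] by blast
  qed
  have less: "lead X r < lead Z r" if r: "[r - 1 = i] (mod int n)" for r
  proof -
    have rP: "r \<in> P" using r by (simp add: P_def)
    have "X (r - 1) (lead X r) \<noteq> 0"
      using lead_nonzero[OF X, of "r - 1"] leadP(1)[OF rP] by simp
    then have "Z r (lead X r) = 0"
      using r leadP(3)[OF rP] by (simp add: Zrow field_simps)
    then show ?thesis using le[of r] lead_nonzero[OF Zgroup, of r] by (cases "lead X r = lead Z r") auto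
  qed
  show ?thesis
    by (rule that[OF n2 a Zgroup Ztnn XZ Zrow le less])
qed

text \<open>
  Iterating the elimination until no two consecutive rows have the same leading column. The rows are bounded on the
  right by the diagonal \<open>j = i + N\<close>, so the total distance of the leading columns from this diagonal
  over one period strictly decreases and stays nonnegative. The entries on that diagonal never change,
  because the row that is subtracted vanishes there.
\<close>

lemma whitney_reduction:
  assumes n: "n \<ge> 1"
  shows "X \<in> loop_group n \<Longrightarrow> totally_nonnegative X \<Longrightarrow> (\<And>i j. j > i + N \<Longrightarrow> X i j = 0) \<Longrightarrow>
    \<exists>G Y s. G \<in> f_products n \<and> Y \<in> loop_group n \<and> totally_nonnegative Y \<and> X = bmul G Y \<and>
      (\<forall>i. lead Y i = i + s) \<and> (\<forall>i j. j > i + N \<longrightarrow> Y i j = 0) \<and> (\<forall>i. Y i (i + N) = X i (i + N))"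
proof (induction "nat (\<Sum>i = 1..int n. i + N - lead X i)" arbitrary: X rule: less_induct)
  case (less X)
  note X = less.prems(1) and tnn = less.prems(2) and upper = less.prems(3)
  show ?case
  proof (cases "\<forall>i. lead X i < lead X (i + 1)")
    case True
    then obtain s where "\<And>i. lead X i = i + s"
      using lead_strict_shift[OF n X] by blast
    then show ?thesis
      using X tnn upper by (intro exI[of _ id_bimatrix] exI[of _ X] exI[of _ s]) (auto simp: bmul_id_left intro: f_products.id)
  next
    case False
    then obtain i0 where "lead X i0 = lead X (i0 + 1)"
      using lead_step_mono[OF X tnn] by (metis order_le_less)
    then obtain i where i: "lead X i = lead X (i + 1)" "lead X (i + 1) < lead X (i + 2)"
      by (rule lead_last_of_run[OF n X tnn])
    obtain a Z where n2: "n \<ge> 2" and a: "a > 0" and Z: "Z \<in> loop_group n" "totally_nonnegative Z"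
      and XZ: "X = bmul (chevalley_f_bimatrix n i a) Z" 
      and Zrow: "\<And>r l. Z r l = X r l + (if [r - 1 = i] (mod int n) then - a else 0) * X (r - 1) l"
      and le: "\<And>r. lead X r \<le> lead Z r" and less': "\<And>r. [r - 1 = i] (mod int n) \<Longrightarrow> lead X r < lead Z r"
      by (rule whitney_elimination[OF n X tnn i]) blast
    have Zupper: "Z r l = 0" if "l > r + N" for r l
      using upper[of r l] upper[of "r - 1" l] that by (simp add: Zrow)
    have Zdiag: "Z r (r + N) = X r (r + N)" for r
      using upper[of "r - 1" "r + N"] by (simp add: Zrow)
    have bound: "lead Z r \<le> r + N" for r
      using Zupper[of r "lead Z r"] lead_nonzero[OF Z(1), of r] by force
    define r where "r = i mod int n + 1"
    have r: "r \<in> {1..int n}" "[r - 1 = i] (mod int n)"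
      using n by (auto simp: r_def add1_zle_eq)
    have "(\<Sum>k = 1..int n. k + N - lead Z k) < (\<Sum>k = 1..int n. k + N - lead X k)"
      by (rule sum_strict_mono_ex1) (use le less'[OF r(2)] r(1) in auto)
    moreover have "0 \<le> (\<Sum>k = 1..int n. k + N - lead Z k)"
      using bound by (intro sum_nonneg) simp
    ultimately have "nat (\<Sum>k = 1..int n. k + N - lead Z k) < nat (\<Sum>k = 1..int n. k + N - lead X k)"
      by linarith
    from less.hyps[OF this Z Zupper]
    obtain G Y s where IH: "G \<in> f_products n" "Y \<in> loop_group n" "totally_nonnegative Y" "Z = bmul G Y"
      "\<forall>i. lead Y i = i + s" "\<forall>i j. j > i + N \<longrightarrow> Y i j = 0" "\<forall>i. Y i (i + N) = Z i (i + N)"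
      by blast
    have "X = bmul (bmul (chevalley_f_bimatrix n i a) G) Y"
      unfolding XZ IH(4)
      by (intro bmul_assoc[symmetric] loop_group_row_finite[OF f_in_loop_group[OF n2]]
          loop_group_row_finite[OF f_products_in_loop_group[OF IH(1)]])
    moreover have "bmul (chevalley_f_bimatrix n i a) G \<in> f_products n"
      by (rule f_products.step[OF n2 a IH(1)])
    ultimately show ?thesis
      using IH Zdiag by metis
  qed
qed

text \<open>
  Suppose row \<open>i\<close> of \<open>Z\<close> is supported between the columns \<open>i + s\<close> and \<open>i\<close>, and is nonzero at both ends. Let \<open>V\<close> be
  the inverse, and consider the column 0 of \<open>V\<close>. Its lowest nonzero entry, in row \<open>Max K\<close>, is met by row
  \<open>Max K - s\<close> of \<open>Z\<close> in a single nonzero product, so the entry of \<open>Z V\<close> there is nonzero, and \<open>Max K = s\<close>.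
  In the same way its highest nonzero entry is in row 0. Hence \<open>0 \<le> s\<close>.
\<close>

lemma triangular_extreme_diagonals:
  assumes Z: "Z \<in> loop_group n"
    and upper: "\<And>i j. j > i \<Longrightarrow> Z i j = 0" "\<And>i. Z i i \<noteq> 0"
    and lower: "\<And>i j. j < i + s \<Longrightarrow> Z i j = 0" "\<And>i. Z i (i + s) \<noteq> 0"
  shows "s \<ge> 0"
proof -
  obtain V where V: "loop_matrix n V" "bmul Z V = id_bimatrix"
    using Z by (auto simp: loop_group_def)
  obtain M where M: "V i j \<noteq> 0 \<Longrightarrow> \<bar>j - i\<bar> \<le> M" for i j
    using V(1) by (auto simp: loop_matrix_def)
  define K where "K = {k. V k 0 \<noteq> 0}"
  have fin: "finite K"
  proof (rule finite_subset)
    show "K \<subseteq> {- M..M}"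
    proof
      fix k assume "k \<in> K"
      then show "k \<in> {- M..M}" using M[of k 0] by (auto simp: K_def)
    qed
  qed simp
  have "bmul Z V 0 0 \<noteq> 0" using V(2) by (simp add: id_bimatrix_def)
  then have ne: "K \<noteq> {}" by (auto simp: K_def elim: bmul_nonzero)
  note row = loop_group_row_finite[OF Z]
  have "bmul Z V (Max K - s) 0 = Z (Max K - s) (Max K) * V (Max K) 0"
  proof (rule bmul_unique_term[OF row])
    fix k assume "k \<noteq> Max K"
    then have "k < Max K \<or> k \<notin> K" using Max_ge[OF fin, of k] by force
    then show "Z (Max K - s) k = 0 \<or> V k 0 = 0"
      using lower(1)[of k "Max K - s"] by (auto simp: K_def)
  qed
  also have "\<dots> \<noteq> 0"
    using Max_in[OF fin ne] lower(2)[of "Max K - s"] by (simp add: K_def)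
  finally have max: "Max K = s" unfolding V(2) by (auto simp: id_bimatrix_def split: if_splits)
  have "bmul Z V (Min K) 0 = Z (Min K) (Min K) * V (Min K) 0"
  proof (rule bmul_unique_term[OF row])
    fix k assume "k \<noteq> Min K"
    then have "k > Min K \<or> k \<notin> K" using Min_le[OF fin, of k] by force
    then show "Z (Min K) k = 0 \<or> V k 0 = 0"
      using upper(1)[of "Min K" k] by (auto simp: K_def)
  qed
  also have "\<dots> \<noteq> 0"
    using Min_in[OF fin ne] upper(2)[of "Min K"] by (simp add: K_def)
  finally have "Min K = 0" unfolding V(2) by (auto simp: id_bimatrix_def split: if_splits)
  then show ?thesis using Min_le[OF fin Max_in[OF fin ne]] max by simp
qed

section \<open>Factorization into generators\<close>

definition generated_bimatrices :: "nat \<Rightarrow> bimatrix set" where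
  "generated_bimatrices n = unfolding_mat n ` generated_semigroup (generators n)"

lemma generated_bimatrices_mult:
  assumes n: "n \<ge> 1" and "X \<in> generated_bimatrices n" "Y \<in> generated_bimatrices n"
  shows "bmul X Y \<in> generated_bimatrices n"
proof -
  obtain A B where AB: "A \<in> generated_semigroup (generators n)" "B \<in> generated_semigroup (generators n)"
    "X = unfolding_mat n A" "Y = unfolding_mat n B"
    using assms(2,3) by (auto simp: generated_bimatrices_def)
  then have "bmul X Y = unfolding_mat n (A * B)"
    by (simp add: unfolding_mult[OF n generated_carrier generated_carrier])
  then show ?thesis
    using generated_semigroup.mult[OF AB(1,2)] by (simp add: generated_bimatrices_def)
qed

lemma generated_bimatricesI:
  "A \<in> generators n \<Longrightarrow> unfolding_mat n A = X \<Longrightarrow> X \<in> generated_bimatrices n"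
  unfolding generated_bimatrices_def using generated_semigroup.generator by blast

text \<open>
  The torus element has the entry \<open>d (i + 1)\<close> in position \<open>i\<close>, as rows are counted from 0 on the folded side.
\<close>

lemma diag_generated:
  assumes n: "n \<ge> 1" and per: "\<And>i. d (i + int n) = d i" and pos: "\<And>i. d i > 0"
  shows "diag_bimatrix d \<in> generated_bimatrices n"
proof (rule generated_bimatricesI)
  let ?A = "mat_diag n (\<lambda>i. Poly_Mapping.single 0 (d (int i + 1))) :: laurent mat"
  show "?A \<in> generators n"
    using pos by (auto simp: generators_def positive_torus_def)
  have nat: "d (i + int k * int n) = d i" for i k
  proof (induction k)
    case (Suc k)
    then show ?case using per[of "i + int k * int n"] by (simp add: algebra_simps)
  qed simp
  have "d ((i - 1) mod int n + 1) = d i" for i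
  proof (cases "(i - 1) div int n \<ge> 0")
    case True
    then show ?thesis using nat[of "(i - 1) mod int n + 1" "nat ((i - 1) div int n)"] by (simp add: algebra_simps)
  next
    case False
    then show ?thesis using nat[of i "nat (- ((i - 1) div int n))"]
      by (simp add: algebra_simps minus_div_mult_eq_mod[symmetric])
  qed
  then show "unfolding_mat n ?A = diag_bimatrix d"
    unfolding unfolding_torus[OF n] using n by (intro ext) (simp add: diag_bimatrix_def)
qed

lemma id_generated: "n \<ge> 1 \<Longrightarrow> id_bimatrix \<in> generated_bimatrices n"
proof -
  assume "n \<ge> 1"
  then have "diag_bimatrix (\<lambda>_. 1) \<in> generated_bimatrices n" by (rule diag_generated) auto
  moreover have "diag_bimatrix (\<lambda>_. 1) = id_bimatrix" by (intro ext) (simp add: diag_bimatrix_def id_bimatrix_def)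
  ultimately show ?thesis by simp
qed

lemma shift_generated:
  assumes n: "n \<ge> 1"
  shows "shift_power s \<in> generated_bimatrices n"
proof -
  have S: "shift_power 1 \<in> generated_bimatrices n"
    by (rule generated_bimatricesI[OF _ unfolding_shift[OF n]]) (simp add: generators_def)
  let ?B = "folding_mat n (shift_power (- 1))"
  have B: "unfolding_mat n ?B = shift_power (- 1)"
    by (rule unfolding_folding_loop[OF n loop_group_matrix[OF shift_in_loop_group]])
  have c: "shift_mat n \<in> carrier_mat n n" "?B \<in> carrier_mat n n" by (simp_all add: shift_mat_def)
  have add: "bmul (shift_power s) (shift_power t) = shift_power (s + t)" for s t
    by (intro ext, unfold bmul_shift) (auto simp: shift_power_def)
  have zero: "shift_power 0 = id_bimatrix" by (intro ext) (auto simp: shift_power_def id_bimatrix_def)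
  have "shift_mat n * ?B = 1\<^sub>m n" "?B * shift_mat n = 1\<^sub>m n"
    using c by (auto intro!: unfolding_mat_inject[of _ n] mult_carrier_mat[of _ n n]
      simp: unfolding_mult[OF n] B unfolding_shift[OF n] unfolding_one[OF n] add zero)
  then have "?B \<in> shift_inverses n"
    using c(2) by (simp add: shift_inverses_def inverts_mat_def
        carrier_matD(1)[OF c(1)] carrier_matD(1)[OF c(2)])
  then have S': "shift_power (- 1) \<in> generated_bimatrices n"
    by (intro generated_bimatricesI[OF _ B]) (simp add: generators_def)
  show ?thesis
  proof (induction s rule: int_induct[where k = 0])
    case base
    then show ?case unfolding zero by (rule id_generated[OF n])
  next
    case (step1 i)
    then show ?case using generated_bimatrices_mult[OF n _ S] add[of i 1] by metis
  next
    case (step2 i)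
    then show ?case using generated_bimatrices_mult[OF n _ S'] add[of i "- 1"] by (metis diff_conv_add_uminus)
  qed
qed

lemma chevalley_e_bimatrix_cong: "[k = k'] (mod int n) \<Longrightarrow> chevalley_e_bimatrix n k a = chevalley_e_bimatrix n k' a"
  by (intro ext) (auto simp: chevalley_e_bimatrix_def dest: cong_trans cong_sym)

lemma e_f_generated:
  assumes n: "n \<ge> 2" and a: "a > 0"
  shows "chevalley_e_bimatrix n k a \<in> generated_bimatrices n" "chevalley_f_bimatrix n k a \<in> generated_bimatrices n"
proof -
  define k' where "k' = (k - 1) mod int n + 1"
  have k': "1 \<le> k'" "k' \<le> int n" using n by (simp_all add: k'_def add1_zle_eq)
  have "[k' = (k - 1) + 1] (mod int n)"
    unfolding k'_def by (intro cong_add) auto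
  then have cong: "chevalley_e_bimatrix n k' a = chevalley_e_bimatrix n k a" by (intro chevalley_e_bimatrix_cong) simp
  have "chevalley_e n k' a \<in> generators n" "chevalley_f n k' a \<in> generators n"
    using n a k' by (auto simp: generators_def positive_chevalley_generators_def)
  moreover have "unfolding_mat n (chevalley_e n k' a) = chevalley_e_bimatrix n k a"
    using n unfolding_chevalley_e[of n k' a] cong by simp
  moreover have "unfolding_mat n (chevalley_f n k' a) = chevalley_f_bimatrix n k a"
    using n unfolding_chevalley_f[of n k' a] cong by (intro ext) (simp add: chevalley_f_bimatrix_def)
  ultimately show "chevalley_e_bimatrix n k a \<in> generated_bimatrices n" "chevalley_f_bimatrix n k a \<in> generated_bimatrices n"
    using generated_bimatricesI by blast+
qed

lemma f_products_generated:
  assumes n: "n \<ge> 1" and "G \<in> f_products n"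
  shows "G \<in> generated_bimatrices n" "reverse_bimatrix G \<in> generated_bimatrices n"
proof -
  have "G \<in> generated_bimatrices n \<and> reverse_bimatrix G \<in> generated_bimatrices n"
    using assms(2)
  proof (induction rule: f_products.induct)
    case id
    then show ?case using id_generated[OF n] by simp
  next
    case (step a G k)
    then show ?case
      by (auto simp: reverse_bmul reverse_f intro!: generated_bimatrices_mult[OF n] e_f_generated)
  qed
  then show "G \<in> generated_bimatrices n" "reverse_bimatrix G \<in> generated_bimatrices n" by auto
qed

text \<open>
  A first round of eliminations leaves a matrix \<open>Y\<close> whose leading entries lie on one diagonal \<open>j = i + s\<close>; a shift makes it
  upper triangular with nonzero diagonal. A second round, applied to the reversal \<open>W\<close>, leaves a lower
  triangular matrix \<open>Z\<close> whose leading entries again lie on one diagonal, and the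
  existence of a banded inverse forces this to be the main diagonal. So \<open>Z\<close> lies in the torus.
\<close>

lemma nonneg_loop_generated:
  assumes n: "n \<ge> 1" and X: "X \<in> loop_group n" and tnn: "totally_nonnegative X"
  shows "X \<in> generated_bimatrices n"
proof -
  obtain N where N: "X i j \<noteq> 0 \<Longrightarrow> \<bar>j - i\<bar> \<le> N" for i j
    using loop_group_matrix[OF X] by (auto simp: loop_matrix_def)
  have "X i j = 0" if "j > i + N" for i j
    using N[of i j] that by force
  then obtain G Y s where G: "G \<in> f_products n" and Y: "Y \<in> loop_group n" "totally_nonnegative Y"
    and XGY: "X = bmul G Y" and lead: "\<And>i. lead Y i = i + s"
    using whitney_reduction[OF n X tnn, of N] by blast
  define U where "U = bmul (shift_power (- s)) Y"
  have U: "U \<in> loop_group n" "totally_nonnegative U"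
    unfolding U_def using Y by (auto intro: loop_group_bmul shift_in_loop_group totally_nonnegative_shift)
  have Urow: "U i j = Y (i - s) j" for i j
    unfolding U_def by (simp add: bmul_shift)
  have Ulow: "U i j = 0" if "j < i" for i j
    unfolding Urow using zero_before_lead[OF Y(1)] lead that by simp
  have Udiag: "U i i \<noteq> 0" for i
    unfolding Urow using lead_nonzero[OF Y(1), of "i - s"] lead by simp
  have YU: "Y = bmul (shift_power s) U"
    by (intro ext) (simp add: bmul_shift Urow)
  define W where "W = reverse_bimatrix U"
  have W: "W \<in> loop_group n" "totally_nonnegative W"
    unfolding W_def using U by (auto intro: loop_group_reverse totally_nonnegative_reverse)
  have "W i j = 0" if "j > i + 0" for i j
    using Ulow that by (simp add: W_def reverse_bimatrix_def)
  then obtain G' Z s' where G': "G' \<in> f_products n" and Z: "Z \<in> loop_group n" "totally_nonnegative Z"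
    and WGZ: "W = bmul G' Z" and lead': "\<And>i. lead Z i = i + s'"
    and Zup: "\<And>i j. j > i \<Longrightarrow> Z i j = 0" and ZW: "\<And>i. Z i i = W i i"
    using whitney_reduction[OF n W, of 0] by auto
  have Zdiag: "Z i i \<noteq> 0" for i
    using Udiag[of "- i"] by (simp add: ZW W_def reverse_bimatrix_def)
  have "s' \<le> 0" using lead_le[OF Z(1) Zdiag[of 0]] lead'[of 0] by simp
  moreover have "s' \<ge> 0"
  proof (rule triangular_extreme_diagonals[OF Z(1)])
    show "Z i j = 0" if "j > i" for i j using that by (rule Zup)
    show "Z i j = 0" if "j < i + s'" for i j
      using zero_before_lead[OF Z(1)] lead' that by simp
    show "Z i (i + s') \<noteq> 0" for i
      using lead_nonzero[OF Z(1), of i] lead' by simp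
  qed (rule Zdiag)
  ultimately have Zlow: "Z i j = 0" if "j < i" for i j
    using zero_before_lead[OF Z(1)] lead' that by simp
  have "reverse_bimatrix Z = diag_bimatrix (\<lambda>i. Z (- i) (- i))"
    using Zup Zlow by (intro ext) (auto simp: reverse_bimatrix_def diag_bimatrix_def neq_iff)
  moreover have "diag_bimatrix (\<lambda>i. Z (- i) (- i)) \<in> generated_bimatrices n"
  proof (rule diag_generated[OF n])
    show "Z (- (i + int n)) (- (i + int n)) = Z (- i) (- i)" for i
      using loop_group_periodic[OF Z(1), of "- i" "- 1" "- i"] by simp
    show "Z (- i) (- i) > 0" for i
      using Zdiag[of "- i"] totally_nonnegative_entry[OF Z(2), of "- i" "- i"] by simp
  qed
  ultimately have "reverse_bimatrix Z \<in> generated_bimatrices n" by simp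
  moreover have "U = bmul (reverse_bimatrix G') (reverse_bimatrix Z)"
    using arg_cong[OF WGZ, of reverse_bimatrix] by (simp add: W_def reverse_bmul)
  ultimately have "U \<in> generated_bimatrices n"
    using generated_bimatrices_mult[OF n f_products_generated(2)[OF n G']] by simp
  then show ?thesis
    unfolding XGY YU
    by (intro generated_bimatrices_mult[OF n] f_products_generated(1)[OF n G] shift_generated[OF n])
qed

theorem theorem2p6:
  fixes n :: nat
  assumes "n \<ge> 1"
  shows "GL_laurent_nonneg n =
    generated_semigroup
      ({shift_mat n} \<union> shift_inverses n \<union> positive_torus n \<union> positive_chevalley_generators n)"
proof -
  have "A \<in> generated_semigroup (generators n)" if A: "A \<in> GL_laurent_nonneg n" for A
  proof -
    have GL: "A \<in> GL_laurent n" "A \<in> carrier_mat n n" and tnn: "totally_nonnegative (unfolding_mat n A)"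
      using A by (auto simp: GL_laurent_nonneg_def GL_laurent_def)
    have "unfolding_mat n A \<in> generated_bimatrices n"
      by (rule nonneg_loop_generated[OF assms unfolding_GL[OF assms GL(1)] tnn])
    then obtain B where B: "B \<in> generated_semigroup (generators n)" "unfolding_mat n A = unfolding_mat n B"
      by (auto simp: generated_bimatrices_def)
    have "A = B"
      by (rule unfolding_mat_inject[OF GL(2) generated_carrier[OF B(1)] B(2)])
    then show ?thesis using B(1) by simp
  qed
  then show ?thesis
    using generated_subset_nonneg[OF assms] unfolding generators_def by blast
qed

end
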